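(* Let $T>0$, $\alpha\in(0,1)$ and $h=1/N_h$ with $N_h$ a positive integer. Let $g$ be an admissible numerical Hamiltonian and $f_h$ an admissible discrete coupling (both defined in the context). Let $u_T:\mathbb{T}^2\to\mathbb{R}$ and let $m_0\in L^1(\mathbb{T}^2)$ with $m_0\ge 0$ and $\int_{\mathbb{T}^2}m_0\,dx=1$. Then for $\Delta t$ sufficiently small (i.e. there is $\tau>0$ such that for every $\Delta t\in(0,\tau)$ for which $N=T/\Delta t$ is an integer) there exists a pair $(U,M)$, with $U=(U^n)_{0\le n\le N}$ and $M=(M^n)_{0\le n\le N}$ families of grid functions on $\mathbb{T}^2_h$, satisfying for all $n=0,\dots,N-1$ and all $i,j$ $$\begin{cases}\bar D_{\Delta t}^{\alpha} U_{i,j}^{n} - (\Delta_h U^{n})_{i,j} + g(x_{i,j},[D_hU^{n}]_{i,j}) = f_h[M^{n+1}]_{i,j},\\ D_{\Delta t}^\alpha M_{i,j}^{n+1} - (\Delta_h M^{n+1})_{i,j} - \mathcal{B}_{i,j}(U^{n},M^{n+1}) = 0,\\ U^{N}_{i,j} = u_T(x_{i,j}),\qquad M_{i,j}^{0}= \frac 1 {h^2} \int_{|x-x_{i,j}|_{\infty}\le h/2} m_0(x)\, dx.\end{cases}$$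
   Context: Grid: $\mathbb{T}^2$ is the unit torus in $\mathbb{R}^2$, $\mathbb{T}^2_h$ the uniform grid of points $x_{i,j}=(ih,jh)$, $h=1/N_h$, with indices $i,j$ taken modulo $N_h$. A grid function is $U=(U_{i,j})$ on $\mathbb{T}^2_h$; $(U,V)_2=h^2\sum_{i,j}U_{i,j}V_{i,j}$, $\|U\|_\infty=\max_{i,j}|U_{i,j}|$; $\overline 1$ is the grid function constantly equal to $1$; $\mathcal{K}_h=\{M: (M,\overline 1)_2=1,\ M_{i,j}\ge 0\}$. Discrete Caputo derivatives (L1 scheme): with $\rho_\alpha=\Gamma(2-\alpha)\Delta t^\alpha$, $D_{\Delta t}^{\alpha} M^{n} = \frac{1}{\rho_\alpha} ( M^{n} - \sum_{k=0}^{n-1} c_k^{n} M^{k})$ for $1\le n\le N$ and $\bar D_{\Delta t}^{\alpha} U^{n} = \frac{1}{\rho_\alpha}( U^{n} - \sum_{k=n+1}^{N} \bar c_{n}^k U^k)$ for $0\le n\le N-1$, where $c_0^n=n^{1-\alpha}-(n-1)^{1-\alpha}$, $c_k^n=2(n-k)^{1-\alpha} - (n+1-k)^{1-\alpha} - (n-1-k)^{1-\alpha}$ for $1\le k\le n-1$; $\bar c_n^k=2(k-n)^{1-\alpha} - (k+1-n)^{1-\alpha} - (k-1-n)^{1-\alpha}$ for $n+1\le k\le N-1$, $\bar c_n^N=(N-n)^{1-\alpha}-(N-1-n)^{1-\alpha}$. Space operators: $(D_1^+U)_{i,j}=(U_{i+1,j}-U_{i,j})/h$, $(D_2^+U)_{i,j}=(U_{i,j+1}-U_{i,j})/h$,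 $[D_hU]_{i,j}=((D_1^+U)_{i,j},(D_1^+U)_{i-1,j},(D_2^+U)_{i,j},(D_2^+U)_{i,j-1})^T\in\mathbb{R}^4$, $(\Delta_hU)_{i,j}=-\frac1{h^2}(4U_{i,j}-U_{i+1,j}-U_{i-1,j}-U_{i,j+1}-U_{i,j-1})$. Admissible numerical Hamiltonian: given a Hamiltonian $H:\mathbb{T}^2\times\mathbb{R}^2\to\mathbb{R}$, a function $g:\mathbb{T}^2\times\mathbb{R}^4\to\mathbb{R}$, $(x,q_1,q_2,q_3,q_4)\mapsto g(x,q_1,q_2,q_3,q_4)$, such that: $g$ is nonincreasing in $q_1,q_3$ and nondecreasing in $q_2,q_4$; $g(x,q_1,q_1,q_2,q_2)=H(x,(q_1,q_2))$; $g$ is of class $C^1$; $q\mapsto g(x,q)$ is convex. Transport operator: writing $g^{(\ell)}_{i,j}=\frac{\partial g}{\partial q_\ell}(x_{i,j},[D_hU]_{i,j})$, $\mathcal{B}_{i,j}(U,M)=\frac1h\big(M_{i,j}g^{(1)}_{i,j}-M_{i-1,j}g^{(1)}_{i-1,j}+M_{i+1,j}g^{(2)}_{i+1,j}-M_{i,j}g^{(2)}_{i,j}+M_{i,j}g^{(3)}_{i,j}-M_{i,j-1}g^{(3)}_{i,j-1}+M_{i,j+1}g^{(4)}_{i,j+1}-M_{i,j}g^{(4)}_{i,j}\big)$. Admissible discrete coupling: let $f$ be an operator sending functions $m$ on $\mathbb{T}^2$ (in a class containing $\mathcal{K}=\{m\in L^1(\mathbb{T}^2):m\ge0,\int_{\mathbb{T}^2}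 m=1\}$) to functions $f[m]$ on $\mathbb{T}^2$. For a grid function $M$, let $m_h$ be the piecewise constant function with value $M_{i,j}$ on $|x-x_{i,j}|_\infty\le h/2$, and $(f_h[M])_{i,j}=f[m_h](x_{i,j})$ (defined whenever $m_h$ is in the class, in particular for $M\in\mathcal{K}_h$). It is assumed that: $f_h$ is continuous on $\mathcal{K}_h$ and maps $\mathcal{K}_h$ to a bounded set of grid functions; for $M,\bar M\in\mathcal{K}_h$, $(f_h[M]-f_h[\bar M],M-\bar M)_2\le0$ implies $M=\bar M$; there is $C$ independent of $h$ with $\|f_h[M]\|_\infty\le C$ and $|f_h[M]_{i,j}-f_h[M]_{\bar i,\bar j}|\le C|x_{i,j}-x_{\bar i,\bar j}|$ for all $M\in\mathcal{K}_h$ and all indices; and $\lim_{h\to0}\sup_{m\in\mathcal{K}}\max_{i,j}|f[m](x_{i,j})-f_h[M_h]_{i,j}|=0$, where $(M_h)_{i,j}=\frac1{h^2}\int_{|x-x_{i,j}|_\infty\le h/2}m\,dx$. *)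

theory Defs
  imports "HOL-Analysis.Analysis"
begin

text \<open>Functions on the unit torus are \<open>\<int>\<^sup>2\<close>-periodic functions on the plane. Grid functions on
  the torus grid with \<open>N\<close> points per direction are functions of two integer indices that are
  \<open>N\<close>-periodic in each of them, so that indices are automatically taken modulo \<open>N\<close>.\<close>

definition torus_fun :: "(real \<times> real \<Rightarrow> 'a) \<Rightarrow> bool" where
  "torus_fun \<phi> \<longleftrightarrow> (\<forall>x y. \<phi> (x + 1, y) = \<phi> (x, y) \<and> \<phi> (x, y + 1) = \<phi> (x, y))"

type_synonym grid_fn = "int \<Rightarrow> int \<Rightarrow> real"

definition grid_fun :: "nat \<Rightarrow> grid_fn \<Rightarrow> bool" where
  "grid_fun N U \<longleftrightarrow> (\<forall>i j. U (i + int N) j = U i j \<and> U i (j + int N) = U i j)"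

definition mesh :: "nat \<Rightarrow> real" where
  "mesh N = 1 / real N"

definition grid_pt :: "nat \<Rightarrow> int \<Rightarrow> int \<Rightarrow> real \<times> real" where
  "grid_pt N i j = (real_of_int i * mesh N, real_of_int j * mesh N)"

definition grid_inner :: "nat \<Rightarrow> grid_fn \<Rightarrow> grid_fn \<Rightarrow> real" where
  "grid_inner N U V = (mesh N)\<^sup>2 * (\<Sum>i\<in>{0..<int N}. \<Sum>j\<in>{0..<int N}. U i j * V i j)"

definition grid_norm_inf :: "nat \<Rightarrow> grid_fn \<Rightarrow> real" where
  "grid_norm_inf N U = Max ((\<lambda>(i, j). \<bar>U i j\<bar>) ` ({0..<int N} \<times> {0..<int N}))"

definition grid_densities :: "nat \<Rightarrow> grid_fn set" where
  "grid_densities N =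
     {M. grid_fun N M \<and> grid_inner N M (\<lambda>i j. 1) = 1 \<and> (\<forall>i j. M i j \<ge> 0)}"

definition densities :: "(real \<times> real \<Rightarrow> real) set" where
  "densities = {m. torus_fun m
     \<and> set_integrable lebesgue ({0..1} \<times> {0..1}) m
     \<and> (AE x in lebesgue. m x \<ge> 0)
     \<and> (LINT x:{0..1} \<times> {0..1}|lebesgue. m x) = 1}"

definition cell :: "nat \<Rightarrow> int \<Rightarrow> int \<Rightarrow> (real \<times> real) set" where
  "cell N i j = {(x, y). \<bar>x - real_of_int i * mesh N\<bar> \<le> mesh N / 2 \<and>
                         \<bar>y - real_of_int j * mesh N\<bar> \<le> mesh N / 2}"

definition cell_average :: "nat \<Rightarrow> (real \<times> real \<Rightarrow> real) \<Rightarrow> grid_fn" where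
  "cell_average N m i j = (1 / (mesh N)\<^sup>2) * (LINT x:cell N i j|lebesgue. m x)"

text \<open>Neighbouring cells overlap on their common edges, a null set; \<open>round\<close> resolves the
  ambiguity there (ties are rounded up).\<close>

definition pw_const :: "nat \<Rightarrow> grid_fn \<Rightarrow> real \<times> real \<Rightarrow> real" where
  "pw_const N M = (\<lambda>(x, y). M (round (x / mesh N)) (round (y / mesh N)))"


definition caputo_rho :: "real \<Rightarrow> real \<Rightarrow> real" where
  "caputo_rho \<alpha> \<Delta>t = Gamma (2 - \<alpha>) * \<Delta>t powr \<alpha>"

text \<open>The bases below are nonnegative and the exponent \<open>1 - \<alpha>\<close> is positive, so \<open>powr\<close>
  is the usual power, including \<open>0 powr (1 - \<alpha>) = 0\<close>.\<close>

definition caputo_c :: "real \<Rightarrow> nat \<Rightarrow> nat \<Rightarrow> real" where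
  "caputo_c \<alpha> n k =
     (if k = 0 then real n powr (1 - \<alpha>) - (real n - 1) powr (1 - \<alpha>)
      else 2 * (real n - real k) powr (1 - \<alpha>) - (real n + 1 - real k) powr (1 - \<alpha>)
             - (real n - 1 - real k) powr (1 - \<alpha>))"

definition caputo_cbar :: "real \<Rightarrow> nat \<Rightarrow> nat \<Rightarrow> nat \<Rightarrow> real" where
  "caputo_cbar \<alpha> N n k =
     (if k = N then (real N - real n) powr (1 - \<alpha>) - (real N - 1 - real n) powr (1 - \<alpha>)
      else 2 * (real k - real n) powr (1 - \<alpha>) - (real k + 1 - real n) powr (1 - \<alpha>)
             - (real k - 1 - real n) powr (1 - \<alpha>))"

definition caputo_fwd :: "real \<Rightarrow> real \<Rightarrow> (nat \<Rightarrow> real) \<Rightarrow> nat \<Rightarrow> real" where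
  "caputo_fwd \<alpha> \<Delta>t M n =
     (1 / caputo_rho \<alpha> \<Delta>t) * (M n - (\<Sum>k\<in>{0..<n}. caputo_c \<alpha> n k * M k))"

definition caputo_bwd :: "real \<Rightarrow> real \<Rightarrow> nat \<Rightarrow> (nat \<Rightarrow> real) \<Rightarrow> nat \<Rightarrow> real" where
  "caputo_bwd \<alpha> \<Delta>t N U n =
     (1 / caputo_rho \<alpha> \<Delta>t) * (U n - (\<Sum>k\<in>{n + 1..N}. caputo_cbar \<alpha> N n k * U k))"


definition D1p :: "nat \<Rightarrow> grid_fn \<Rightarrow> grid_fn" where
  "D1p N U i j = (U (i + 1) j - U i j) / mesh N"

definition D2p :: "nat \<Rightarrow> grid_fn \<Rightarrow> grid_fn" where
  "D2p N U i j = (U i (j + 1) - U i j) / mesh N"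

definition Dh :: "nat \<Rightarrow> grid_fn \<Rightarrow> int \<Rightarrow> int \<Rightarrow> real^4" where
  "Dh N U i j = vector [D1p N U i j, D1p N U (i - 1) j, D2p N U i j, D2p N U i (j - 1)]"

definition laplace_h :: "nat \<Rightarrow> grid_fn \<Rightarrow> grid_fn" where
  "laplace_h N U i j =
     - (1 / (mesh N)\<^sup>2) * (4 * U i j - U (i + 1) j - U (i - 1) j - U i (j + 1) - U i (j - 1))"


text \<open>\<open>C\<^sup>1\<close> regularity on the whole space: everywhere Frechet differentiable, with the derivative
  continuous in the operator norm.\<close>

definition C1_fun :: "('a::real_normed_vector \<Rightarrow> real) \<Rightarrow> bool" where
  "C1_fun \<phi> \<longleftrightarrow> (\<exists>\<phi>' :: 'a \<Rightarrow> 'a \<Rightarrow>\<^sub>L real.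
     (\<forall>x. (\<phi> has_derivative blinfun_apply (\<phi>' x)) (at x)) \<and> continuous_on UNIV \<phi>')"

definition partial_q :: "(real \<times> real \<Rightarrow> real^4 \<Rightarrow> real) \<Rightarrow> 4 \<Rightarrow> real \<times> real \<Rightarrow> real^4 \<Rightarrow> real" where
  "partial_q g l x q = deriv (\<lambda>s. g x (q + s *\<^sub>R axis l 1)) 0"

definition admissible_hamiltonian ::
    "(real \<times> real \<Rightarrow> real^2 \<Rightarrow> real) \<Rightarrow> (real \<times> real \<Rightarrow> real^4 \<Rightarrow> real) \<Rightarrow> bool" where
  "admissible_hamiltonian H g \<longleftrightarrow>
     torus_fun H \<and> torus_fun g
   \<and> (\<forall>x q1 q2 q3 q4.
        antimono (\<lambda>s. g x (vector [s, q2, q3, q4]))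
      \<and> mono (\<lambda>s. g x (vector [q1, s, q3, q4]))
      \<and> antimono (\<lambda>s. g x (vector [q1, q2, s, q4]))
      \<and> mono (\<lambda>s. g x (vector [q1, q2, q3, s])))
   \<and> (\<forall>x q1 q2. g x (vector [q1, q1, q2, q2]) = H x (vector [q1, q2]))
   \<and> C1_fun (\<lambda>(x, q). g x q)
   \<and> (\<forall>x. convex_on UNIV (g x))"

definition transport ::
    "nat \<Rightarrow> (real \<times> real \<Rightarrow> real^4 \<Rightarrow> real) \<Rightarrow> grid_fn \<Rightarrow> grid_fn \<Rightarrow> grid_fn" where
  "transport N g U M i j =
     (let G = (\<lambda>l i j. partial_q g l (grid_pt N i j) (Dh N U i j)) in
      (1 / mesh N) *
        (M i j * G 1 i j - M (i - 1) j * G 1 (i - 1) j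
       + M (i + 1) j * G 2 (i + 1) j - M i j * G 2 i j
       + M i j * G 3 i j - M i (j - 1) * G 3 i (j - 1)
       + M i (j + 1) * G 4 i (j + 1) - M i j * G 4 i j))"


definition coupling_h ::
    "nat \<Rightarrow> ((real \<times> real \<Rightarrow> real) \<Rightarrow> real \<times> real \<Rightarrow> real) \<Rightarrow> grid_fn \<Rightarrow> grid_fn" where
  "coupling_h N f M i j = f (pw_const N M) (grid_pt N i j)"

text \<open>\<open>X\<close> is the class on which the operator \<open>f\<close> is defined; values of \<open>f\<close> outside \<open>X\<close> carry no
  meaning. Continuity of \<open>coupling_h\<close> is for the product topology on \<open>grid_fn\<close>, which on
  \<open>N\<close>-periodic functions is the topology of the maximum norm. Boundedness is stated with
  \<open>grid_norm_inf\<close>, because the library metric on function spaces is itself bounded. In the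
  Lipschitz condition \<open>i, j, i', j'\<close> range over all integers, hence over all lifts of the grid
  points to the plane, so the bound is by the distance on the torus. The supremum in the
  consistency condition is taken in the extended reals, since finiteness is not assumed.\<close>

definition admissible_coupling ::
    "(real \<times> real \<Rightarrow> real) set \<Rightarrow> ((real \<times> real \<Rightarrow> real) \<Rightarrow> real \<times> real \<Rightarrow> real) \<Rightarrow> bool" where
  "admissible_coupling X f \<longleftrightarrow>
     densities \<subseteq> X
   \<and> (\<forall>m\<in>X. torus_fun m \<and> torus_fun (f m))
   \<and> (\<forall>N>0. continuous_on (grid_densities N) (coupling_h N f))
   \<and> (\<forall>N>0. \<exists>B. \<forall>M\<in>grid_densities N. grid_norm_inf N (coupling_h N f M) \<le> B)
   \<and> (\<forall>N>0. \<forall>M\<in>grid_densities N. \<forall>M'\<in>grid_densities N.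
        grid_inner N (\<lambda>i j. coupling_h N f M i j - coupling_h N f M' i j)
                     (\<lambda>i j. M i j - M' i j) \<le> 0 \<longrightarrow> M = M')
   \<and> (\<exists>C. \<forall>N>0. \<forall>M\<in>grid_densities N.
        grid_norm_inf N (coupling_h N f M) \<le> C
      \<and> (\<forall>i j i' j'. \<bar>coupling_h N f M i j - coupling_h N f M i' j'\<bar>
                       \<le> C * dist (grid_pt N i j) (grid_pt N i' j')))
   \<and> ((\<lambda>N. SUP m\<in>densities. ereal (grid_norm_inf N
          (\<lambda>i j. f m (grid_pt N i j) - coupling_h N f (cell_average N m) i j))) \<longlonglongrightarrow> 0)"

end

theory Submission
  imports Defs
begin

text \<open>The whole system is one finite-dimensional zero problem, solved by the Poincare-Miranda
  theorem (obtained here from Kuhn's combinatorial lemma) on a box of pairs \<open>(U, M)\<close>; neither the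
  Hamilton-Jacobi nor the Fokker-Planck scheme has to be solved separately.

  For the components of \<open>U\<close> the map is the residual of the Hamilton-Jacobi equation. The Caputo weights
  are nonnegative with sum 1, so for a box \<open>\<bar>U\<^sup>n\<bar> \<le> R\<^sub>n\<close> whose radii grow backwards in time by a
  large enough amount per step, monotonicity of \<open>g\<close> gives this residual the right sign on the faces.

  For the components of \<open>M\<close> the map is \<open>M - M'\<close>, where \<open>M'\<close> is a damped Richardson step for the
  linear Fokker-Planck scheme. Its matrix has nonpositive off-diagonal entries, and the discrete
  Laplacian and transport have zero mean, so for a small enough step \<open>M'\<close> is again a density, and
  \<open>M = M'\<close> holds only if the residual vanishes.\<close>

section \<open>The Poincare-Miranda theorem\<close>

text \<open>Tychonoff's theorem for a product of intervals. Countability of the index type makes the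
  function space first countable, so that compactness yields convergent subsequences in
  \<open>poincare_miranda\<close>.\<close>

lemma compact_real_box:
  fixes a b :: "'i::countable \<Rightarrow> real"
  shows "compact {x. \<forall>i. a i \<le> x i \<and> x i \<le> b i}"
proof -
  have "compactin (product_topology (\<lambda>i. euclidean) UNIV) (\<Pi>\<^sub>E i\<in>UNIV. {a i..b i})"
    by (simp add: compactin_PiE)
  moreover have "(\<Pi>\<^sub>E i\<in>UNIV. {a i..b i}) = {x. \<forall>i. a i \<le> x i \<and> x i \<le> b i}"
    by (auto simp: PiE_def Pi_def)
  ultimately show ?thesis
    by (simp add: euclidean_product_topology)
qed

text \<open>Kuhn's lemma on the lattice that splits each side of the box into \<open>p\<close>
  parts, each lattice point being labelled by the signs of \<open>G\<close>. Coordinates outside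
  \<open>I\<close> are frozen because their interval is a single point. The witnesses
  \<open>r\<close> and \<open>s\<close> depend on the component \<open>i\<close>; only the cell at
  \<open>y\<close> is common to all components.\<close>

lemma kuhn_miranda_mesh:
  fixes G :: "('i \<Rightarrow> real) \<Rightarrow> 'i \<Rightarrow> real" and a b :: "'i \<Rightarrow> real"
  defines "B \<equiv> {x. \<forall>i. a i \<le> x i \<and> x i \<le> b i}"
  assumes "finite I" and ab: "\<And>i. i \<in> I \<Longrightarrow> a i < b i" and ab': "\<And>i. i \<notin> I \<Longrightarrow> a i = b i"
    and lower: "\<And>x i. x \<in> B \<Longrightarrow> i \<in> I \<Longrightarrow> x i = a i \<Longrightarrow> G x i \<le> 0"
    and upper: "\<And>x i. x \<in> B \<Longrightarrow> i \<in> I \<Longrightarrow> x i = b i \<Longrightarrow> G x i \<ge> 0"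
    and "p > (0::nat)"
  shows "\<exists>y\<in>B. \<forall>i\<in>I. \<exists>r\<in>B. \<exists>s\<in>B. (\<forall>j. \<bar>r j - y j\<bar> \<le> (b j - a j) / real p)
           \<and> (\<forall>j. \<bar>s j - y j\<bar> \<le> (b j - a j) / real p) \<and> G r i \<le> 0 \<and> G s i \<ge> 0"
proof -
  define n where "n = card I"
  obtain e where e: "bij_betw e {..<n} I"
    using ex_bij_betw_nat_finite[OF \<open>finite I\<close>] by (auto simp: n_def atLeast0LessThan)
  define d where "d = the_inv_into {..<n} e"
  have d: "d i < n" "e (d i) = i" if "i \<in> I" for i
    using bij_betwE[OF bij_betw_the_inv_into[OF e]] f_the_inv_into_f_bij_betw[OF e] that
    by (auto simp: d_def)
  have de: "d (e k) = k" "e k \<in> I" if "k < n" for k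
    using that e by (auto simp: d_def bij_betw_def the_inv_into_f_f)
  define pt :: "(nat \<Rightarrow> nat) \<Rightarrow> 'i \<Rightarrow> real"
    where "pt v i = (if i \<in> I then a i + (b i - a i) * (real (v (d i)) / real p) else a i)" for v i
  have ptB: "pt v \<in> B" if v: "\<forall>k<n. v k \<le> p" for v
  proof -
    have "a i + (b i - a i) * (real (v (d i)) / real p) \<le> b i"
      "0 \<le> (b i - a i) * (real (v (d i)) / real p)" if "i \<in> I" for i
    proof -
      have "real (v (d i)) / real p \<le> 1"
        using v d[OF that] \<open>p > 0\<close> by (simp add: divide_le_eq)
      then have "(b i - a i) * (real (v (d i)) / real p) \<le> (b i - a i) * 1"
        using ab[OF that] by (intro mult_left_mono) auto
      then show "a i + (b i - a i) * (real (v (d i)) / real p) \<le> b i" by simp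
      show "0 \<le> (b i - a i) * (real (v (d i)) / real p)"
        using ab[OF that] by simp
    qed
    then show ?thesis using ab' by (auto simp: B_def pt_def)
  qed
  have pt0: "pt v (e k) = a (e k)" if "k < n" "v k = 0" for v k
    using that de[of k] by (simp add: pt_def)
  have ptp: "pt v (e k) = b (e k)" if "k < n" "v k = p" for v k
    using that de[of k] \<open>p > 0\<close> by (simp add: pt_def)
  have ptdist: "\<bar>pt r j - pt q j\<bar> \<le> (b j - a j) / real p"
    if rq: "\<forall>k<n. q k \<le> r k \<and> r k \<le> q k + 1" for r q j
  proof (cases "j \<in> I")
    case True
    define \<delta> where "\<delta> = real (r (d j)) - real (q (d j))"
    have \<delta>: "\<delta> \<le> 1" "0 \<le> \<delta>"
      using rq d[OF True] by (force simp: \<delta>_def)+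
    have "pt r j - pt q j = (b j - a j) * \<delta> / real p"
      using True by (simp add: pt_def \<delta>_def right_diff_distrib diff_divide_distrib)
    moreover have "(b j - a j) * \<delta> / real p \<le> (b j - a j) * 1 / real p"
      using ab[OF True] \<delta> by (intro divide_right_mono mult_left_mono) auto
    moreover have "0 \<le> (b j - a j) * \<delta> / real p"
      using ab[OF True] \<delta> by simp
    ultimately show ?thesis by simp
  qed (use ab' in \<open>simp add: pt_def\<close>)
  \<comment> \<open>On a face the label is prescribed instead of being read off from
    \<open>G\<close>, so Kuhn's boundary condition holds even where \<open>G\<close> vanishes there.
    The sign hypotheses \<open>lower\<close> and \<open>upper\<close> keep the prescribed labels
    truthful.\<close>
  define label :: "(nat \<Rightarrow> nat) \<Rightarrow> nat \<Rightarrow> nat" where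
    "label v k = (if v k = 0 then 0 else if v k = p then 1 else if G (pt v) (e k) \<le> 0 then 0 else 1)"
    for v k
  have label0: "G (pt v) (e k) \<le> 0" if "\<forall>k<n. v k \<le> p" "k < n" "label v k = 0" for v k
    using that ptB[of v] lower[of "pt v" "e k"] pt0[of k v] de[of k]
    by (auto simp: label_def split: if_splits)
  have label1: "G (pt v) (e k) \<ge> 0" if "\<forall>k<n. v k \<le> p" "k < n" "label v k \<noteq> 0" for v k
    using that ptB[of v] upper[of "pt v" "e k"] ptp[of k v] de[of k]
    by (auto simp: label_def split: if_splits)
  obtain q where q: "\<forall>k<n. q k < p"
    and rs: "\<forall>k<n. \<exists>r s. (\<forall>j<n. q j \<le> r j \<and> r j \<le> q j + 1) \<and>
                (\<forall>j<n. q j \<le> s j \<and> s j \<le> q j + 1) \<and> label r k \<noteq> label s k"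
    by (rule kuhn_lemma[OF \<open>p > 0\<close>, of n label]) (use \<open>p > 0\<close> in \<open>auto simp: label_def\<close>)
  have "\<exists>r\<in>B. \<exists>s\<in>B. (\<forall>j. \<bar>r j - pt q j\<bar> \<le> (b j - a j) / real p)
           \<and> (\<forall>j. \<bar>s j - pt q j\<bar> \<le> (b j - a j) / real p) \<and> G r i \<le> 0 \<and> G s i \<ge> 0"
    if "i \<in> I" for i
  proof -
    \<comment> \<open>Kuhn's lemma only says that two labels differ; the two points are swapped if
      necessary so that \<open>r\<close> carries the label 0.\<close>
    have *: "\<exists>r s. (\<forall>j<n. q j \<le> r j \<and> r j \<le> q j + 1) \<and> (\<forall>j<n. q j \<le> s j \<and> s j \<le> q j + 1)
        \<and> label r (d i) = 0 \<and> label s (d i) \<noteq> 0"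
    proof -
      obtain r s where rs': "\<forall>j<n. q j \<le> r j \<and> r j \<le> q j + 1" "\<forall>j<n. q j \<le> s j \<and> s j \<le> q j + 1"
        and "label r (d i) \<noteq> label s (d i)"
        using rs d(1)[OF \<open>i \<in> I\<close>] by blast
      then show ?thesis
      proof (cases "label r (d i) = 0")
        case True
        with \<open>label r (d i) \<noteq> label s (d i)\<close> have "label s (d i) \<noteq> 0" by simp
        with True rs' show ?thesis by blast
      next
        case False
        with \<open>label r (d i) \<noteq> label s (d i)\<close> have "label s (d i) = 0"
          by (simp add: label_def split: if_splits)
        with False rs' show ?thesis by blast
      qed
    qed
    then obtain r s where r: "\<forall>j<n. q j \<le> r j \<and> r j \<le> q j + 1" "label r (d i) = 0"
      and s: "\<forall>j<n. q j \<le> s j \<and> s j \<le> q j + 1" "label s (d i) \<noteq> 0" by blast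
    \<comment> \<open>The strict bound \<open>q k < p\<close> keeps every corner of the cell at
      \<open>q\<close> inside the lattice, hence inside the box.\<close>
    have "\<forall>k<n. r k \<le> p" "\<forall>k<n. s k \<le> p"
      using q r s by (metis Suc_eq_plus1 Suc_leI order_trans)+
    then show ?thesis
      using label0[of r "d i"] label1[of s "d i"] ptB ptdist r s d[OF that] by metis
  qed
  moreover have "pt q \<in> B" using q by (intro ptB) auto
  ultimately show ?thesis by blast
qed

text \<open>The approximate zeros of \<open>kuhn_miranda_mesh\<close> have a cluster point by
  compactness. As the mesh shrinks, the points with opposite signs converge to it as well, and
  continuity squeezes each component of \<open>G\<close> to 0.\<close>

lemma poincare_miranda:
  fixes G :: "('i::countable \<Rightarrow> real) \<Rightarrow> 'i \<Rightarrow> real" and a b :: "'i \<Rightarrow> real"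
  defines "B \<equiv> {x. \<forall>i. a i \<le> x i \<and> x i \<le> b i}"
  assumes "finite I" and ab: "\<And>i. i \<in> I \<Longrightarrow> a i < b i" and ab': "\<And>i. i \<notin> I \<Longrightarrow> a i = b i"
    and cont: "\<And>i. i \<in> I \<Longrightarrow> continuous_on B (\<lambda>x. G x i)"
    and lower: "\<And>x i. x \<in> B \<Longrightarrow> i \<in> I \<Longrightarrow> x i = a i \<Longrightarrow> G x i \<le> 0"
    and upper: "\<And>x i. x \<in> B \<Longrightarrow> i \<in> I \<Longrightarrow> x i = b i \<Longrightarrow> G x i \<ge> 0"
  obtains x where "x \<in> B" "\<And>i. i \<in> I \<Longrightarrow> G x i = 0"
proof -
  have "\<exists>y\<in>B. \<forall>i\<in>I. \<exists>r\<in>B. \<exists>s\<in>B. (\<forall>j. \<bar>r j - y j\<bar> \<le> (b j - a j) / real (Suc m))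
           \<and> (\<forall>j. \<bar>s j - y j\<bar> \<le> (b j - a j) / real (Suc m)) \<and> G r i \<le> 0 \<and> G s i \<ge> 0" for m
    using assms unfolding B_def by (intro kuhn_miranda_mesh) auto
  then obtain y where yB: "\<And>m. y m \<in> B"
    and y: "\<And>m. \<forall>i\<in>I. \<exists>r\<in>B. \<exists>s\<in>B. (\<forall>j. \<bar>r j - y m j\<bar> \<le> (b j - a j) / real (Suc m))
           \<and> (\<forall>j. \<bar>s j - y m j\<bar> \<le> (b j - a j) / real (Suc m)) \<and> G r i \<le> 0 \<and> G s i \<ge> 0"
    by metis
  have "seq_compact B"
    unfolding B_def by (intro compact_imp_seq_compact compact_real_box)
  then obtain x \<sigma> where xB: "x \<in> B" and "strict_mono \<sigma>" and lim: "(y \<circ> \<sigma>) \<longlonglongrightarrow> x"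
    using yB unfolding seq_compact_def by metis
  have small: "(\<lambda>m. (b j - a j) / real (Suc (\<sigma> m))) \<longlonglongrightarrow> 0" for j
    using LIMSEQ_subseq_LIMSEQ[OF LIMSEQ_Suc[OF lim_const_over_n[of "b j - a j"]] \<open>strict_mono \<sigma>\<close>]
    by (simp add: o_def)
  \<comment> \<open>Convergence in the function space is coordinatewise, so points within one mesh
    width of \<open>y\<close> in each coordinate share its limit.\<close>
  have near: "r \<longlonglongrightarrow> x" if "\<And>m j. \<bar>r m j - y (\<sigma> m) j\<bar> \<le> (b j - a j) / real (Suc (\<sigma> m))" for r
  proof -
    have "(\<lambda>m. r m j) \<longlonglongrightarrow> x j" for j
    proof -
      have "(\<lambda>m. r m j - y (\<sigma> m) j) \<longlonglongrightarrow> 0"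
        using that by (intro Lim_null_comparison[OF _ small[of j]]) auto
      moreover have "(\<lambda>m. y (\<sigma> m) j) \<longlonglongrightarrow> x j"
        using continuous_on_tendsto_compose[OF continuous_on_product_coordinates lim] by (simp add: o_def)
      ultimately show ?thesis using tendsto_add by fastforce
    qed
    then have "limitin (product_topology (\<lambda>i. euclidean) UNIV) r x sequentially"
      by (simp add: limitin_componentwise)
    then show ?thesis
      by (simp add: euclidean_product_topology)
  qed
  have "G x i = 0" if "i \<in> I" for i
  proof (rule antisym)
    have "\<forall>m. \<exists>r\<in>B. (\<forall>j. \<bar>r j - y (\<sigma> m) j\<bar> \<le> (b j - a j) / real (Suc (\<sigma> m))) \<and> G r i \<le> 0"
      using y that by meson
    then obtain r where r: "\<And>m. r m \<in> B" "\<And>m. G (r m) i \<le> 0"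
      "\<And>m j. \<bar>r m j - y (\<sigma> m) j\<bar> \<le> (b j - a j) / real (Suc (\<sigma> m))" by metis
    show "G x i \<le> 0"
      by (rule LIMSEQ_le_const2[OF continuous_on_tendsto_compose[OF cont[OF that] near[OF r(3)] xB]])
        (use r in auto)
    have "\<forall>m. \<exists>r\<in>B. (\<forall>j. \<bar>r j - y (\<sigma> m) j\<bar> \<le> (b j - a j) / real (Suc (\<sigma> m))) \<and> G r i \<ge> 0"
      using y that by meson
    then obtain s where s: "\<And>m. s m \<in> B" "\<And>m. G (s m) i \<ge> 0"
      "\<And>m j. \<bar>s m j - y (\<sigma> m) j\<bar> \<le> (b j - a j) / real (Suc (\<sigma> m))" by metis
    show "G x i \<ge> 0"
      by (rule LIMSEQ_le_const[OF continuous_on_tendsto_compose[OF cont[OF that] near[OF s(3)] xB]])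
        (use s in auto)
  qed
  then show thesis using that xB by blast
qed

section \<open>Caputo weights and grid means\<close>

text \<open>Time reversal: the backward weights are the forward ones counted from the final time, so
  only the latter have to be analysed.\<close>

lemma caputo_cbar_eq:
  assumes "n < k" "k \<le> N"
  shows "caputo_cbar \<alpha> N n k = caputo_c \<alpha> (N - n) (N - k)"
  using assms by (auto simp: caputo_cbar_def caputo_c_def of_nat_diff algebra_simps)

lemma caputo_rho_pos:
  assumes "0 < \<alpha>" "\<alpha> < 1" "0 < \<Delta>t"
  shows "caputo_rho \<alpha> \<Delta>t > 0"
  using assms by (simp add: caputo_rho_def Gamma_real_pos)

text \<open>Midpoint concavity of the power. The second derivative criterion works on the positive
  reals, so \<open>t = 1\<close>, where the left point is 0, is treated separately.\<close>

lemma powr_second_difference_nonpos: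
  fixes \<beta> t :: real
  assumes "0 \<le> \<beta>" "\<beta> \<le> 1" and t: "t \<ge> 1"
  shows "(t + 1) powr \<beta> + (t - 1) powr \<beta> \<le> 2 * t powr \<beta>"
proof (cases "t = 1")
  case True
  have "(2::real) powr \<beta> \<le> 2 powr 1" using assms by (intro powr_mono) auto
  then show ?thesis using True by simp
next
  case False
  have "concave_on {0<..} (\<lambda>x. x powr \<beta>)"
    using assms by (intro f''_le0_imp_concave derivative_eq_intros | simp add: mult_le_0_iff)+
  then have "\<And>x y u v. x > 0 \<Longrightarrow> y > 0 \<Longrightarrow> u \<ge> 0 \<Longrightarrow> v \<ge> 0 \<Longrightarrow> u + v = 1 \<Longrightarrow>
      u * x powr \<beta> + v * y powr \<beta> \<le> (u * x + v * y) powr \<beta>"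
    by (simp add: concave_on_iff)
  from this[of "t + 1" "t - 1" "1/2" "1/2"] False t show ?thesis by (simp add: add_divide_distrib diff_divide_distrib)
qed

lemma caputo_c_nonneg:
  assumes "0 < \<alpha>" "\<alpha> < 1" "k < n"
  shows "caputo_c \<alpha> n k \<ge> 0"
proof (cases "k = 0")
  case True
  have "(real n - 1) powr (1 - \<alpha>) \<le> real n powr (1 - \<alpha>)"
    using assms by (intro powr_mono2) auto
  then show ?thesis using True by (simp add: caputo_c_def)
next
  case False
  have "real n - real k \<ge> 1" using assms by linarith
  with powr_second_difference_nonpos[of "1 - \<alpha>" "real n - real k"] False assms
  show ?thesis by (simp add: caputo_c_def algebra_simps)
qed

text \<open>The weights with \<open>k\<close> at least 1 telescope as differences of
  \<open>\<phi>\<close>. Here \<open>\<phi> n\<close> is 1 and \<open>\<phi> 1\<close> is exactly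
  the weight at \<open>k = 0\<close>, which restores the total.\<close>

lemma sum_caputo_c:
  assumes "\<alpha> < 1" "n > 0"
  shows "(\<Sum>k\<in>{0..<n}. caputo_c \<alpha> n k) = 1"
proof -
  define \<phi> where "\<phi> k = (real n + 1 - real k) powr (1 - \<alpha>) - (real n - real k) powr (1 - \<alpha>)" for k
  have "(\<Sum>k\<in>{1..<n}. caputo_c \<alpha> n k) = (\<Sum>k\<in>{1..<n}. \<phi> (Suc k) - \<phi> k)"
    by (intro sum.cong) (auto simp: caputo_c_def \<phi>_def algebra_simps)
  also have "\<dots> = \<phi> n - \<phi> 1"
    using assms by (simp add: sum_Suc_diff')
  finally show ?thesis
    using assms by (subst sum.atLeast_Suc_lessThan) (auto simp: caputo_c_def \<phi>_def)
qed

lemma sum_caputo_cbar: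
  assumes "n < N"
  shows "(\<Sum>k\<in>{n + 1..N}. caputo_cbar \<alpha> N n k * V k)
       = (\<Sum>k\<in>{0..<N - n}. caputo_c \<alpha> (N - n) k * V (N - k))"
  by (rule sum.reindex_bij_witness[where i = "\<lambda>k. N - k" and j = "\<lambda>k. N - k"])
    (use assms in \<open>auto simp: caputo_cbar_eq\<close>)

section \<open>Means of grid functions and discrete conservation of mass\<close>

abbreviation grid_mean :: "nat \<Rightarrow> grid_fn \<Rightarrow> real" where
  "grid_mean N U \<equiv> grid_inner N U (\<lambda>i j. 1)"

lemma grid_mean_add: "grid_mean N (\<lambda>i j. U i j + V i j) = grid_mean N U + grid_mean N V"
  by (simp add: grid_inner_def sum.distrib algebra_simps)

lemma grid_mean_diff: "grid_mean N (\<lambda>i j. U i j - V i j) = grid_mean N U - grid_mean N V"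
  by (simp add: grid_inner_def sum_subtractf algebra_simps)

lemma grid_mean_scale: "grid_mean N (\<lambda>i j. c * U i j) = c * grid_mean N U"
  by (simp add: grid_inner_def sum_distrib_left mult_ac)

lemma grid_mean_divide: "grid_mean N (\<lambda>i j. U i j / c) = grid_mean N U / c"
  using grid_mean_scale[of N "1 / c" U] by simp

lemma grid_mean_sum:
  "grid_mean N (\<lambda>i j. \<Sum>k\<in>K. V k i j) = (\<Sum>k\<in>K. grid_mean N (V k))"
  by (induction K rule: infinite_finite_induct) (simp_all add: grid_mean_add, simp_all add: grid_inner_def)

lemma grid_mean_const: "N > 0 \<Longrightarrow> grid_mean N (\<lambda>i j. c) = c"
  by (simp add: grid_inner_def mesh_def power2_eq_square)

text \<open>The shifted window loses the index 0 and gains the index \<open>N\<close>, where the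
  values agree.\<close>

lemma sum_shift_periodic:
  fixes \<psi> :: "int \<Rightarrow> real"
  assumes "\<And>i. \<psi> (i + int N) = \<psi> i"
  shows "(\<Sum>i\<in>{0..<int N}. \<psi> (i + 1)) = (\<Sum>i\<in>{0..<int N}. \<psi> i)"
proof (cases "N = 0")
  case False
  have "(\<Sum>i\<in>{0..<int N}. \<psi> (i + 1)) = (\<Sum>i\<in>{1..<int N + 1}. \<psi> i)"
    by (rule sum.reindex_bij_witness[where i = "\<lambda>i. i - 1" and j = "\<lambda>i. i + 1"]) auto
  also have "{1..<int N + 1} = insert (int N) {1..<int N}" using False by auto
  also have "(\<Sum>i\<in>\<dots>. \<psi> i) = \<psi> 0 + (\<Sum>i\<in>{1..<int N}. \<psi> i)" using assms[of 0] by simp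
  also have "\<dots> = (\<Sum>i\<in>insert 0 {1..<int N}. \<psi> i)" by simp
  also have "insert 0 {1..<int N} = {0..<int N}" using False by auto
  finally show ?thesis .
qed simp

text \<open>Sums over one period are translation invariant in each variable. The backward shifts
  follow by applying the forward ones to the function already shifted back.\<close>

lemma grid_mean_shift:
  assumes "grid_fun N U"
  shows "grid_mean N (\<lambda>i j. U (i + 1) j) = grid_mean N U"
    "grid_mean N (\<lambda>i j. U i (j + 1)) = grid_mean N U"
    "grid_mean N (\<lambda>i j. U (i - 1) j) = grid_mean N U"
    "grid_mean N (\<lambda>i j. U i (j - 1)) = grid_mean N U"
proof -
  have 1: "grid_mean N (\<lambda>i j. V (i + 1) j) = grid_mean N V" if "grid_fun N V" for V
    using that sum_shift_periodic[of "\<lambda>i. \<Sum>j\<in>{0..<int N}. V i j" N]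
    by (simp add: grid_inner_def grid_fun_def)
  have 2: "grid_mean N (\<lambda>i j. V i (j + 1)) = grid_mean N V" if "grid_fun N V" for V
    using that sum_shift_periodic[of "V i" N for i] by (simp add: grid_inner_def grid_fun_def)
  have "grid_fun N (\<lambda>i j. U (i - 1) j)" "grid_fun N (\<lambda>i j. U i (j - 1))"
    using assms unfolding grid_fun_def by (metis add_diff_eq diff_add_eq)+
  from 1[OF assms] 2[OF assms] 1[OF this(1)] 2[OF this(2)]
  show "grid_mean N (\<lambda>i j. U (i + 1) j) = grid_mean N U"
    "grid_mean N (\<lambda>i j. U i (j + 1)) = grid_mean N U"
    "grid_mean N (\<lambda>i j. U (i - 1) j) = grid_mean N U"
    "grid_mean N (\<lambda>i j. U i (j - 1)) = grid_mean N U" by simp_all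
qed

text \<open>Each of the four neighbour terms has the same mean as the centre term, so diffusion
  conserves mass.\<close>

lemma grid_mean_laplace:
  assumes "grid_fun N U"
  shows "grid_mean N (laplace_h N U) = 0"
proof -
  have "laplace_h N U = (\<lambda>i j. - (1 / (mesh N)\<^sup>2) *
          (4 * U i j - U (i + 1) j - U (i - 1) j - U i (j + 1) - U i (j - 1)))"
    by (simp add: laplace_h_def fun_eq_iff)
  then show ?thesis
    by (simp only: grid_mean_scale grid_mean_diff grid_mean_shift[OF assms]) simp
qed

section \<open>Numerical Hamiltonian, Fokker-Planck and Hamilton-Jacobi residuals\<close>

lemma vector_4_nth:
  "(vector [a, b, c, d] :: 'a::zero^4) $ 1 = a" "(vector [a, b, c, d] :: 'a::zero^4) $ 2 = b"
  "(vector [a, b, c, d] :: 'a::zero^4) $ 3 = c" "(vector [a, b, c, d] :: 'a::zero^4) $ 4 = d"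
  by (simp_all add: vector_def)

text \<open>Chain rule along the line through \<open>q\<close> in direction \<open>axis l 1\<close>:
  the partial derivative is the Frechet derivative applied to \<open>(0, axis l 1)\<close>, and
  inherits its continuity.\<close>

lemma partial_q_C1:
  assumes "C1_fun (\<lambda>(x, q). g x q)"
  shows "((\<lambda>s. g x (q + s *\<^sub>R axis l 1)) has_real_derivative partial_q g l x q) (at 0)"
    and "continuous_on UNIV (partial_q g l x)"
    and "continuous_on UNIV (g x)"
proof -
  obtain g' where g': "\<And>z. ((\<lambda>(x, q). g x q) has_derivative blinfun_apply (g' z)) (at z)"
    and cont: "continuous_on UNIV g'"
    using assms by (auto simp: C1_fun_def)
  have D: "((\<lambda>s. g x (q + s *\<^sub>R axis l 1)) has_real_derivative g' (x, q) (0, axis l 1)) (at 0)" for q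
  proof -
    have "((\<lambda>s. (x, q + s *\<^sub>R axis l 1)) has_derivative (\<lambda>s. (0, s *\<^sub>R axis l 1))) (at (0::real))"
      by (auto intro!: derivative_eq_intros)
    from diff_chain_at[OF this, of "\<lambda>(x, q). g x q" "blinfun_apply (g' (x, q))"] g'[of "(x, q)"]
    have "((\<lambda>s. g x (q + s *\<^sub>R axis l 1)) has_derivative (\<lambda>s. g' (x, q) (0, s *\<^sub>R axis l 1))) (at 0)"
      by (simp add: o_def)
    moreover have "g' (x, q) (0, s *\<^sub>R axis l 1) = g' (x, q) (0, axis l 1) * s" for s :: real
      using blinfun.scaleR_right[of "g' (x, q)" s "(0, axis l 1)"] by simp
    ultimately show ?thesis by (simp add: has_field_derivative_def mult_commute_abs)
  qed
  then have eq: "partial_q g l x q = g' (x, q) (0, axis l 1)" for q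
    unfolding partial_q_def by (rule DERIV_imp_deriv)
  show "((\<lambda>s. g x (q + s *\<^sub>R axis l 1)) has_real_derivative partial_q g l x q) (at 0)"
    using D eq by simp
  have "continuous_on UNIV (\<lambda>q. g' (x, q))"
    by (rule continuous_on_compose2[OF cont]) (auto intro!: continuous_intros)
  then show "continuous_on UNIV (partial_q g l x)"
    by (auto simp: eq[abs_def] intro!: continuous_intros)
  have "continuous_on UNIV (\<lambda>(x, q). g x q)"
    using g' by (meson continuous_at_imp_continuous_on has_derivative_continuous)
  then show "continuous_on UNIV (g x)"
    using continuous_on_compose2[where f = "\<lambda>q. (x, q)" and s = UNIV and t = UNIV]
    by (force intro!: continuous_intros)
qed

text \<open>Monotonicity in one coordinate fixes the sign of the derivative. These signs make the
  off-diagonal entries of the Fokker-Planck matrix nonpositive.\<close>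

lemma partial_q_sign:
  assumes "admissible_hamiltonian H g"
  shows "partial_q g 1 x q \<le> 0" "partial_q g 2 x q \<ge> 0"
    "partial_q g 3 x q \<le> 0" "partial_q g 4 x q \<ge> 0"
proof -
  have C1: "C1_fun (\<lambda>(x, q). g x q)"
    using assms by (simp add: admissible_hamiltonian_def)
  have mono:
    "mono (\<lambda>s. - g x (q + s *\<^sub>R axis 1 1))" "mono (\<lambda>s. g x (q + s *\<^sub>R axis 2 1))"
    "mono (\<lambda>s. - g x (q + s *\<^sub>R axis 3 1))" "mono (\<lambda>s. g x (q + s *\<^sub>R axis 4 1))"
  proof -
    have "q + s *\<^sub>R axis 1 1 = vector [q $ 1 + s, q $ 2, q $ 3, q $ 4]"
      "q + s *\<^sub>R axis 2 1 = vector [q $ 1, q $ 2 + s, q $ 3, q $ 4]"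
      "q + s *\<^sub>R axis 3 1 = vector [q $ 1, q $ 2, q $ 3 + s, q $ 4]"
      "q + s *\<^sub>R axis 4 1 = vector [q $ 1, q $ 2, q $ 3, q $ 4 + s]" for s
      by (simp_all add: vec_eq_iff forall_4 vector_4_nth axis_def)
    moreover have "antimono (\<lambda>s. g x (vector [s, q $ 2, q $ 3, q $ 4]))"
      "mono (\<lambda>s. g x (vector [q $ 1, s, q $ 3, q $ 4]))"
      "antimono (\<lambda>s. g x (vector [q $ 1, q $ 2, s, q $ 4]))"
      "mono (\<lambda>s. g x (vector [q $ 1, q $ 2, q $ 3, s]))"
      using assms unfolding admissible_hamiltonian_def by blast+
    ultimately show "mono (\<lambda>s. - g x (q + s *\<^sub>R axis 1 1))" "mono (\<lambda>s. g x (q + s *\<^sub>R axis 2 1))"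
      "mono (\<lambda>s. - g x (q + s *\<^sub>R axis 3 1))" "mono (\<lambda>s. g x (q + s *\<^sub>R axis 4 1))"
      by (auto simp: mono_def antimono_def)
  qed
  note D = partial_q_C1(1)[OF C1, of x q]
  have *: "d \<ge> 0" if "mono \<phi>" "(\<phi> has_real_derivative d) (at 0)" for \<phi> :: "real \<Rightarrow> real" and d
    using mono_on_imp_deriv_nonneg[OF that] by simp
  show "partial_q g 1 x q \<le> 0" using *[OF mono(1) DERIV_minus[OF D]] by simp
  show "partial_q g 2 x q \<ge> 0" using *[OF mono(2) D] .
  show "partial_q g 3 x q \<le> 0" using *[OF mono(3) DERIV_minus[OF D]] by simp
  show "partial_q g 4 x q \<ge> 0" using *[OF mono(4) D] .
qed

text \<open>Passes from \<open>r\<close> to \<open>q\<close> one coordinate at a time. With the zero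
  vector as one of the two arguments it compares \<open>g\<close> at a spatial extremum with its
  value at zero gradient.\<close>

lemma admissible_hamiltonian_mono:
  assumes "admissible_hamiltonian H g"
    and "q $ 1 \<le> r $ 1" "r $ 2 \<le> q $ 2" "q $ 3 \<le> r $ 3" "r $ 4 \<le> q $ 4"
  shows "g x r \<le> g x q"
proof -
  have v: "vector [p $ 1, p $ 2, p $ 3, p $ 4] = p" for p :: "real^4"
    by (simp add: vec_eq_iff forall_4 vector_4_nth)
  have m: "antimono (\<lambda>s. g x (vector [s, q2, q3, q4]))" "mono (\<lambda>s. g x (vector [q1, s, q3, q4]))"
    "antimono (\<lambda>s. g x (vector [q1, q2, s, q4]))" "mono (\<lambda>s. g x (vector [q1, q2, q3, s]))"
    for q1 q2 q3 q4
    using assms(1) unfolding admissible_hamiltonian_def by blast+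
  have "g x r = g x (vector [r $ 1, r $ 2, r $ 3, r $ 4])" by (simp add: v)
  also have "\<dots> \<le> g x (vector [q $ 1, r $ 2, r $ 3, r $ 4])" by (rule antimonoD[OF m(1) assms(2)])
  also have "\<dots> \<le> g x (vector [q $ 1, q $ 2, r $ 3, r $ 4])" by (rule monoD[OF m(2) assms(3)])
  also have "\<dots> \<le> g x (vector [q $ 1, q $ 2, q $ 3, r $ 4])" by (rule antimonoD[OF m(3) assms(4)])
  also have "\<dots> \<le> g x (vector [q $ 1, q $ 2, q $ 3, q $ 4])" by (rule monoD[OF m(4) assms(5)])
  finally show ?thesis by (simp add: v)
qed

section \<open>Periodicity of the discrete operators\<close>

lemma grid_pt_shift:
  assumes "N > 0"
  shows "grid_pt N (i + int N) j = (fst (grid_pt N i j) + 1, snd (grid_pt N i j))"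
    "grid_pt N i (j + int N) = (fst (grid_pt N i j), snd (grid_pt N i j) + 1)"
  using assms by (simp_all add: grid_pt_def mesh_def field_simps)

lemma torus_fun_grid_pt:
  assumes "torus_fun \<phi>" "N > 0"
  shows "\<phi> (grid_pt N (i + int N) j) = \<phi> (grid_pt N i j)"
    "\<phi> (grid_pt N i (j + int N)) = \<phi> (grid_pt N i j)"
  using assms by (simp_all add: grid_pt_shift torus_fun_def)

lemma grid_fun_shift:
  assumes "grid_fun N U"
  shows "U (i + int N + a) j = U (i + a) j" "U i (j + int N + a) = U i (j + a)"
    "U (i + int N - a) j = U (i - a) j" "U i (j + int N - a) = U i (j - a)"
    "U (i + int N) j = U i j" "U i (j + int N) = U i j"
  using assms unfolding grid_fun_def
  by (metis add.assoc add.commute add_diff_eq diff_add_eq)+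

lemma Dh_shift:
  assumes "grid_fun N U"
  shows "Dh N U (i + int N) j = Dh N U i j" "Dh N U i (j + int N) = Dh N U i j"
  using assms by (simp_all add: Dh_def D1p_def D2p_def grid_fun_shift
      grid_fun_shift(3)[where a = 1])

text \<open>These are the coefficients of the transport operator; naming them separates the
  nonlinear dependence on \<open>U\<close> from the linear dependence on \<open>M\<close>.\<close>

definition drift ::
    "nat \<Rightarrow> (real \<times> real \<Rightarrow> real^4 \<Rightarrow> real) \<Rightarrow> grid_fn \<Rightarrow> 4 \<Rightarrow> grid_fn" where
  "drift N g U l i j = partial_q g l (grid_pt N i j) (Dh N U i j)"

lemma grid_fun_drift:
  assumes "torus_fun g" "N > 0" "grid_fun N U"
  shows "grid_fun N (drift N g U l)"
  using assms by (simp add: grid_fun_def drift_def partial_q_def Dh_shift torus_fun_grid_pt)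

lemma transport_eq:
  "transport N g U M i j = (1 / mesh N) *
     (M i j * drift N g U 1 i j - M (i - 1) j * drift N g U 1 (i - 1) j
    + M (i + 1) j * drift N g U 2 (i + 1) j - M i j * drift N g U 2 i j
    + M i j * drift N g U 3 i j - M i (j - 1) * drift N g U 3 i (j - 1)
    + M i (j + 1) * drift N g U 4 i (j + 1) - M i j * drift N g U 4 i j)"
  by (simp add: transport_def drift_def)

lemma grid_fun_transport:
  assumes "torus_fun g" "N > 0" "grid_fun N U" "grid_fun N M"
  shows "grid_fun N (transport N g U M)"
  using assms grid_fun_drift[OF assms(1-3)]
  by (simp add: grid_fun_def[of N "transport N g U M"] transport_eq grid_fun_shift)

lemma grid_fun_laplace: "grid_fun N U \<Longrightarrow> grid_fun N (laplace_h N U)"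
  by (simp add: grid_fun_def[of N "laplace_h N U"] laplace_h_def grid_fun_shift)

text \<open>Transport is in divergence form: every flux \<open>P l\<close> occurs together with its
  own shift of opposite sign, and the means cancel.\<close>

lemma grid_mean_transport:
  assumes "torus_fun g" "N > 0" "grid_fun N U" "grid_fun N M"
  shows "grid_mean N (transport N g U M) = 0"
proof -
  define P where "P l i j = M i j * drift N g U l i j" for l i j
  have P: "grid_fun N (P l)" for l
    using grid_fun_drift[OF assms(1-3)] assms(4) by (simp add: P_def grid_fun_def)
  have "transport N g U M = (\<lambda>i j. (1 / mesh N) * (P 1 i j - P 1 (i - 1) j + P 2 (i + 1) j
      - P 2 i j + P 3 i j - P 3 i (j - 1) + P 4 i (j + 1) - P 4 i j))"
    by (simp add: transport_eq P_def fun_eq_iff)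
  then show ?thesis
    by (simp only: grid_mean_scale grid_mean_diff grid_mean_add grid_mean_shift[OF P]) simp
qed

section \<open>The Fokker-Planck scheme and its damped step\<close>

definition fp_residual ::
    "real \<Rightarrow> real \<Rightarrow> nat \<Rightarrow> (real \<times> real \<Rightarrow> real^4 \<Rightarrow> real) \<Rightarrow> (nat \<Rightarrow> grid_fn) \<Rightarrow> (nat \<Rightarrow> grid_fn) \<Rightarrow>
     nat \<Rightarrow> grid_fn" where
  "fp_residual \<alpha> \<Delta>t N g U M n i j = caputo_fwd \<alpha> \<Delta>t (\<lambda>k. M k i j) (n + 1)
     - laplace_h N (M (n + 1)) i j - transport N g (U n) (M (n + 1)) i j"

text \<open>This is the diagonal coefficient of minus Laplacian minus transport; the Caputo term
  adds \<open>1 / caputo_rho \<alpha> \<Delta>t\<close> to it.\<close>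

definition fp_diag ::
    "nat \<Rightarrow> (real \<times> real \<Rightarrow> real^4 \<Rightarrow> real) \<Rightarrow> grid_fn \<Rightarrow> grid_fn" where
  "fp_diag N g U i j = 4 / (mesh N)\<^sup>2
     + (drift N g U 2 i j - drift N g U 1 i j + drift N g U 4 i j - drift N g U 3 i j) / mesh N"

text \<open>The sum of all diagonal entries dominates each of them and, unlike a step size chosen from a
  bound on the drift, needs no a priori bound on \<open>U\<close>.\<close>

definition fp_rate ::
    "real \<Rightarrow> real \<Rightarrow> nat \<Rightarrow> (real \<times> real \<Rightarrow> real^4 \<Rightarrow> real) \<Rightarrow> grid_fn \<Rightarrow> real" where
  "fp_rate \<alpha> \<Delta>t N g U = 1 / caputo_rho \<alpha> \<Delta>t
     + (\<Sum>i\<in>{0..<int N}. \<Sum>j\<in>{0..<int N}. fp_diag N g U i j)"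

text \<open>The inverse rate is the damping factor. All levels up to \<open>n + 1\<close> enter as
  simultaneous unknowns, not as data computed earlier.\<close>

definition fp_step ::
    "real \<Rightarrow> real \<Rightarrow> nat \<Rightarrow> (real \<times> real \<Rightarrow> real^4 \<Rightarrow> real) \<Rightarrow> (nat \<Rightarrow> grid_fn) \<Rightarrow> (nat \<Rightarrow> grid_fn) \<Rightarrow>
     nat \<Rightarrow> grid_fn" where
  "fp_step \<alpha> \<Delta>t N g U M n i j =
     M (n + 1) i j - fp_residual \<alpha> \<Delta>t N g U M n i j / fp_rate \<alpha> \<Delta>t N g (U n)"

text \<open>Induction on the number of periods; a negative number is reduced to a positive one by
  starting from the shifted point. Values at all indices are thus read off from one fundamental
  square.\<close>

lemma grid_fun_mod:
  assumes "grid_fun N U"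
  shows "U i j = U (i mod int N) (j mod int N)"
proof -
  have pos: "U (i + int k * int N) j = U i j" "U i (j + int k * int N) = U i j" for i j k
  proof (induction k)
    case (Suc k)
    have "U (i + int (Suc k) * int N) j = U ((i + int k * int N) + int N) j"
      "U i (j + int (Suc k) * int N) = U i ((j + int k * int N) + int N)"
      by (simp_all add: algebra_simps)
    with Suc assms show "U (i + int (Suc k) * int N) j = U i j" "U i (j + int (Suc k) * int N) = U i j"
      unfolding grid_fun_def by metis+
  qed simp_all
  have 1: "U (i + c * int N) j = U i j" for i j c
    using pos(1)[of i "nat c" j] pos(1)[of "i + c * int N" "nat (- c)" j]
    by (cases "c \<ge> 0") (simp_all add: algebra_simps)
  have 2: "U i (j + c * int N) = U i j" for i j c
    using pos(2)[of i j "nat c"] pos(2)[of i "j + c * int N" "nat (- c)"]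
    by (cases "c \<ge> 0") (simp_all add: algebra_simps)
  have "U i j = U (i mod int N + (i div int N) * int N) (j mod int N + (j div int N) * int N)"
    by simp
  also have "\<dots> = U (i mod int N) (j mod int N)" by (simp only: 1 2)
  finally show ?thesis .
qed

lemma fp_diag_nonneg:
  assumes "admissible_hamiltonian H g"
  shows "fp_diag N g U i j \<ge> 0"
  using partial_q_sign[OF assms, of "grid_pt N i j" "Dh N U i j"]
  by (simp add: fp_diag_def drift_def mesh_def)

text \<open>Periodicity moves the index into the fundamental square, where one nonnegative term is
  bounded by the double sum.\<close>

lemma fp_diag_le_rate:
  assumes "admissible_hamiltonian H g" "N > 0" "grid_fun N U"
  shows "1 / caputo_rho \<alpha> \<Delta>t + fp_diag N g U i j \<le> fp_rate \<alpha> \<Delta>t N g U"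
proof -
  have "torus_fun g" using assms(1) by (simp add: admissible_hamiltonian_def)
  then have "grid_fun N (fp_diag N g U)"
    using grid_fun_drift[OF _ assms(2,3)] by (simp add: grid_fun_def fp_diag_def)
  then have "fp_diag N g U i j = fp_diag N g U (i mod int N) (j mod int N)"
    by (rule grid_fun_mod)
  also have "\<dots> \<le> (\<Sum>j\<in>{0..<int N}. fp_diag N g U (i mod int N) j)"
    using assms(2) fp_diag_nonneg[OF assms(1)] by (intro member_le_sum) auto
  also have "\<dots> \<le> (\<Sum>i\<in>{0..<int N}. \<Sum>j\<in>{0..<int N}. fp_diag N g U i j)"
    using assms(2) fp_diag_nonneg[OF assms(1)]
    by (intro member_le_sum[where f = "\<lambda>i. \<Sum>j\<in>{0..<int N}. fp_diag N g U i j"] sum_nonneg) auto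
  finally show ?thesis by (simp add: fp_rate_def)
qed

lemma fp_rate_pos:
  assumes "admissible_hamiltonian H g" "0 < \<alpha>" "\<alpha> < 1" "0 < \<Delta>t"
  shows "fp_rate \<alpha> \<Delta>t N g U > 0"
  unfolding fp_rate_def using caputo_rho_pos[OF assms(2-4)] fp_diag_nonneg[OF assms(1)]
  by (intro add_pos_nonneg sum_nonneg) auto

text \<open>Mass: the history \<open>S\<close> has mean 1 because the Caputo weights sum to 1, and
  Laplacian and transport have mean 0, so the residual has mean 0. Sign: the step multiplied by the
  rate is a combination of nonnegative quantities with nonnegative coefficients.\<close>

lemma fp_step_mem_densities:
  assumes H: "admissible_hamiltonian H g" and \<alpha>: "0 < \<alpha>" "\<alpha> < 1" "0 < \<Delta>t" and "N > 0"
    and U: "grid_fun N (U n)" and M: "\<And>k. k \<le> n + 1 \<Longrightarrow> M k \<in> grid_densities N"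
  shows "fp_step \<alpha> \<Delta>t N g U M n \<in> grid_densities N"
proof -
  define \<rho> \<mu> where "\<rho> = caputo_rho \<alpha> \<Delta>t" and "\<mu> = fp_rate \<alpha> \<Delta>t N g (U n)"
  have "\<rho> > 0" "\<mu> > 0"
    using caputo_rho_pos[OF \<alpha>] fp_rate_pos[OF H \<alpha>] by (simp_all add: \<rho>_def \<mu>_def)
  have h: "mesh N > 0" using \<open>N > 0\<close> by (simp add: mesh_def)
  have torus: "torus_fun g" using H by (simp add: admissible_hamiltonian_def)
  define S where "S i j = (\<Sum>k\<in>{0..<n + 1}. caputo_c \<alpha> (n + 1) k * M k i j)" for i j
  have Mfun: "grid_fun N (M k)" and Mmean: "grid_mean N (M k) = 1" and Mpos: "M k i j \<ge> 0"
    if "k \<le> n + 1" for k i j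
    using M[OF that] by (auto simp: grid_densities_def)
  have Spos: "S i j \<ge> 0" for i j
    unfolding S_def using Mpos caputo_c_nonneg[OF \<alpha>(1,2)] by (intro sum_nonneg mult_nonneg_nonneg) auto
  have Smean: "grid_mean N S = 1"
    unfolding S_def[abs_def] using Mmean sum_caputo_c[OF \<alpha>(2), of "n + 1"]
    by (simp add: grid_mean_sum grid_mean_scale del: sum.op_ivl_Suc)
  have Sfun: "grid_fun N S"
    using Mfun unfolding S_def grid_fun_def by (auto intro!: sum.cong)
  have res: "fp_residual \<alpha> \<Delta>t N g U M n i j = (M (n + 1) i j - S i j) / \<rho>
      - laplace_h N (M (n + 1)) i j - transport N g (U n) (M (n + 1)) i j" for i j
    by (simp add: fp_residual_def caputo_fwd_def S_def \<rho>_def)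
  have step: "fp_step \<alpha> \<Delta>t N g U M n = (\<lambda>i j. M (n + 1) i j - ((M (n + 1) i j - S i j) / \<rho>
      - laplace_h N (M (n + 1)) i j - transport N g (U n) (M (n + 1)) i j) / \<mu>)"
    by (simp add: fun_eq_iff fp_step_def res \<mu>_def)
  have "grid_mean N (fp_step \<alpha> \<Delta>t N g U M n) = 1"
    unfolding step using Mfun Mmean Smean grid_mean_laplace[OF Mfun] grid_mean_transport[OF torus \<open>N > 0\<close> U Mfun]
    by (simp only: grid_mean_diff grid_mean_divide) simp
  moreover have "grid_fun N (fp_step \<alpha> \<Delta>t N g U M n)"
    using Mfun[of "n + 1"] Sfun grid_fun_laplace[OF Mfun, of "n + 1"]
      grid_fun_transport[OF torus \<open>N > 0\<close> U Mfun, of "n + 1"]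
    unfolding step by (simp add: grid_fun_def)
  moreover have "fp_step \<alpha> \<Delta>t N g U M n i j \<ge> 0" for i j
  proof -
    let ?M = "M (n + 1)" and ?G = "drift N g (U n)"
    have G: "?G 1 i j \<le> 0" "?G 2 i j \<ge> 0" "?G 3 i j \<le> 0" "?G 4 i j \<ge> 0" for i j
      using partial_q_sign[OF H] by (simp_all add: drift_def)
    \<comment> \<open>Collects the terms by grid point. The coefficient at \<open>(i, j)\<close> is
      the rate minus the diagonal of the residual, nonnegative by \<open>fp_diag_le_rate\<close>;
      drifts 1 and 3 are nonpositive and therefore appear negated.\<close>
    have "\<mu> * fp_step \<alpha> \<Delta>t N g U M n i j = (\<mu> - (1 / \<rho> + fp_diag N g (U n) i j)) * ?M i j + S i j / \<rho>
        + (?M (i + 1) j + ?M (i - 1) j + ?M i (j + 1) + ?M i (j - 1)) / (mesh N)\<^sup>2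
        + (?M (i - 1) j * - ?G 1 (i - 1) j + ?M (i + 1) j * ?G 2 (i + 1) j
           + ?M i (j - 1) * - ?G 3 i (j - 1) + ?M i (j + 1) * ?G 4 i (j + 1)) / mesh N"
    proof -
      have scale: "\<mu> * (a - r / \<mu>) = \<mu> * a - r" for a r
        using \<open>\<mu> > 0\<close> by (simp add: field_simps)
      have "\<mu> * fp_step \<alpha> \<Delta>t N g U M n i j = \<mu> * ?M i j - ((?M i j - S i j) / \<rho>
        - laplace_h N ?M i j - transport N g (U n) ?M i j)"
        unfolding step using scale .
      then show ?thesis
        by (simp add: laplace_h_def transport_eq fp_diag_def algebra_simps add_divide_distrib diff_divide_distrib)
    qed
    also have "\<dots> \<ge> 0"
    proof -
      have "1 / \<rho> + fp_diag N g (U n) i j \<le> \<mu>"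
        unfolding \<rho>_def \<mu>_def by (rule fp_diag_le_rate[OF H \<open>N > 0\<close> U])
      moreover have "?M i j \<ge> 0" for i j using Mpos by simp
      ultimately show ?thesis
        using Spos \<open>\<rho> > 0\<close> h G by (intro add_nonneg_nonneg mult_nonneg_nonneg divide_nonneg_pos) auto
    qed
    finally show ?thesis using \<open>\<mu> > 0\<close> by (simp add: zero_le_mult_iff)
  qed
  ultimately show ?thesis by (simp add: grid_densities_def)
qed

section \<open>The Hamilton-Jacobi scheme at spatial extrema\<close>

definition hj_residual ::
    "real \<Rightarrow> real \<Rightarrow> nat \<Rightarrow> nat \<Rightarrow> (real \<times> real \<Rightarrow> real^4 \<Rightarrow> real) \<Rightarrow> grid_fn \<Rightarrow> (nat \<Rightarrow> grid_fn) \<Rightarrow>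
     nat \<Rightarrow> grid_fn" where
  "hj_residual \<alpha> \<Delta>t Nt N g F U n i j = caputo_bwd \<alpha> \<Delta>t Nt (\<lambda>k. U k i j) n
     - laplace_h N (U n) i j + g (grid_pt N i j) (Dh N (U n) i j) - F i j"

text \<open>The later values are averaged with nonnegative weights of sum 1, so a common gap of
  \<open>caputo_rho \<alpha> \<Delta>t * K\<close> below \<open>V n\<close> survives the averaging,
  and the division by \<open>caputo_rho \<alpha> \<Delta>t\<close> leaves \<open>K\<close>.\<close>

lemma caputo_bwd_lower:
  assumes \<alpha>: "0 < \<alpha>" "\<alpha> < 1" "0 < \<Delta>t" and "n < Nt"
    and V: "\<And>k. n < k \<Longrightarrow> k \<le> Nt \<Longrightarrow> V k \<le> V n - caputo_rho \<alpha> \<Delta>t * K"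
  shows "K \<le> caputo_bwd \<alpha> \<Delta>t Nt V n"
proof -
  define \<rho> where "\<rho> = caputo_rho \<alpha> \<Delta>t"
  have "\<rho> > 0" unfolding \<rho>_def by (rule caputo_rho_pos[OF \<alpha>])
  have "(\<Sum>k\<in>{n + 1..Nt}. caputo_cbar \<alpha> Nt n k * V k)
      = (\<Sum>k\<in>{0..<Nt - n}. caputo_c \<alpha> (Nt - n) k * V (Nt - k))"
    using \<open>n < Nt\<close> by (rule sum_caputo_cbar)
  also have "\<dots> \<le> (\<Sum>k\<in>{0..<Nt - n}. caputo_c \<alpha> (Nt - n) k * (V n - \<rho> * K))"
    using V caputo_c_nonneg[OF \<alpha>(1,2)] by (intro sum_mono mult_left_mono) (auto simp: \<rho>_def)
  also have "\<dots> = V n - \<rho> * K"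
    using sum_caputo_c[OF \<alpha>(2), of "Nt - n"] \<open>n < Nt\<close> by (simp flip: sum_distrib_right)
  finally show ?thesis
    using \<open>\<rho> > 0\<close> by (simp add: caputo_bwd_def \<rho>_def[symmetric] pos_le_divide_eq mult.commute)
qed

lemma caputo_bwd_uminus: "caputo_bwd \<alpha> \<Delta>t Nt (\<lambda>k. - V k) n = - caputo_bwd \<alpha> \<Delta>t Nt V n"
  by (simp add: caputo_bwd_def sum_negf minus_divide_left)

text \<open>Discrete maximum principle: at a spatial maximum the Laplacian is nonpositive and
  monotonicity bounds \<open>g\<close> below by its value at zero gradient. The gap in time
  contributes \<open>K\<close>, which absorbs the source.\<close>

lemma hj_residual_max:
  assumes H: "admissible_hamiltonian H g" and \<alpha>: "0 < \<alpha>" "\<alpha> < 1" "0 < \<Delta>t" and "N > 0" "n < Nt"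
    and V: "\<And>k. n < k \<Longrightarrow> k \<le> Nt \<Longrightarrow> U k i j \<le> U n i j - caputo_rho \<alpha> \<Delta>t * K"
    and max: "\<And>i' j'. U n i' j' \<le> U n i j"
    and K: "F i j - g (grid_pt N i j) 0 \<le> K"
  shows "hj_residual \<alpha> \<Delta>t Nt N g F U n i j \<ge> 0"
proof -
  have h: "mesh N > 0" using \<open>N > 0\<close> by (simp add: mesh_def)
  have "K \<le> caputo_bwd \<alpha> \<Delta>t Nt (\<lambda>k. U k i j) n"
    using V by (rule caputo_bwd_lower[OF \<alpha> \<open>n < Nt\<close>])
  moreover have "laplace_h N (U n) i j \<le> 0"
    using max[of "i + 1" j] max[of "i - 1" j] max[of i "j + 1"] max[of i "j - 1"] h
    by (simp add: laplace_h_def zero_le_divide_iff)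
  moreover have "g (grid_pt N i j) 0 \<le> g (grid_pt N i j) (Dh N (U n) i j)"
    using max h by (intro admissible_hamiltonian_mono[OF H])
      (simp_all add: Dh_def D1p_def D2p_def vector_4_nth divide_le_0_iff zero_le_divide_iff)
  ultimately show ?thesis using K by (simp add: hj_residual_def)
qed

text \<open>Mirror image at a spatial minimum; the Caputo estimate is applied to the negated
  values.\<close>

lemma hj_residual_min:
  assumes H: "admissible_hamiltonian H g" and \<alpha>: "0 < \<alpha>" "\<alpha> < 1" "0 < \<Delta>t" and "N > 0" "n < Nt"
    and V: "\<And>k. n < k \<Longrightarrow> k \<le> Nt \<Longrightarrow> U n i j + caputo_rho \<alpha> \<Delta>t * K \<le> U k i j"
    and min: "\<And>i' j'. U n i j \<le> U n i' j'"
    and K: "g (grid_pt N i j) 0 - F i j \<le> K"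
  shows "hj_residual \<alpha> \<Delta>t Nt N g F U n i j \<le> 0"
proof -
  have h: "mesh N > 0" using \<open>N > 0\<close> by (simp add: mesh_def)
  have "K \<le> caputo_bwd \<alpha> \<Delta>t Nt (\<lambda>k. - U k i j) n"
    using V by (intro caputo_bwd_lower[OF \<alpha> \<open>n < Nt\<close>]) (simp add: algebra_simps)
  moreover have "laplace_h N (U n) i j \<ge> 0"
    using min[of "i + 1" j] min[of "i - 1" j] min[of i "j + 1"] min[of i "j - 1"] h
    by (simp add: laplace_h_def divide_le_0_iff)
  moreover have "g (grid_pt N i j) (Dh N (U n) i j) \<le> g (grid_pt N i j) 0"
    using min h by (intro admissible_hamiltonian_mono[OF H])
      (simp_all add: Dh_def D1p_def D2p_def vector_4_nth divide_le_0_iff zero_le_divide_iff)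
  ultimately show ?thesis using K by (simp add: hj_residual_def caputo_bwd_uminus)
qed

section \<open>Cell averages and piecewise constant densities\<close>

lemma lebesgue_translate: "lebesgue = distr lebesgue lebesgue ((+) (t :: 'a::euclidean_space))"
  and measurable_lebesgue_translate: "(+) t \<in> lebesgue \<rightarrow>\<^sub>M (lebesgue :: 'a measure)"
proof -
  have *: "(\<lambda>x::'a. t + (\<Sum>j\<in>Basis. (1 * (x \<bullet> j)) *\<^sub>R j)) = (+) t"
    by (simp add: euclidean_representation fun_eq_iff)
  show "lebesgue = distr lebesgue lebesgue ((+) t)"
    using lebesgue_affine_euclidean[of "\<lambda>_. 1" t] unfolding * by (simp add: density_1)
  show "(+) t \<in> lebesgue \<rightarrow>\<^sub>M (lebesgue :: 'a measure)"
    using lebesgue_affine_measurable[of "\<lambda>_. 1" t] unfolding * by simp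
qed

lemma set_integrable_lebesgue_translate:
  fixes f :: "'a::euclidean_space \<Rightarrow> real"
  assumes "set_integrable lebesgue S f" "\<And>x. f (t + x) = f x" "\<And>x. t + x \<in> S \<longleftrightarrow> x \<in> S'"
  shows "set_integrable lebesgue S' f"
proof -
  have "integrable lebesgue (\<lambda>x. indicat_real S (t + x) *\<^sub>R f (t + x))"
    using assms(1) measurable_lebesgue_translate[of t] unfolding set_integrable_def
    by (subst (asm) lebesgue_translate[of t], subst (asm) integrable_distr_eq) auto
  then show ?thesis
    using assms(2,3) by (simp add: set_integrable_def indicator_def)
qed

text \<open>Invariance of Lebesgue measure in the integrable case. Otherwise translating back by
  \<open>- t\<close> shows that neither side is integrable, and both integrals take the default
  value 0.\<close>

lemma set_integral_lebesgue_translate: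
  fixes f :: "'a::euclidean_space \<Rightarrow> real"
  assumes "\<And>x. f (t + x) = f x" "\<And>x. t + x \<in> S \<longleftrightarrow> x \<in> S'"
  shows "(LINT x:S'|lebesgue. f x) = (LINT x:S|lebesgue. f x)"
proof (cases "set_integrable lebesgue S f")
  case True
  have "integral\<^sup>L lebesgue (\<lambda>x. indicat_real S x *\<^sub>R f x)
      = integral\<^sup>L lebesgue (\<lambda>x. indicat_real S (t + x) *\<^sub>R f (t + x))"
    using True measurable_lebesgue_translate[of t] unfolding set_integrable_def
    by (subst lebesgue_translate[of t], subst integral_distr) auto
  then show ?thesis
    using assms by (simp add: set_lebesgue_integral_def indicator_def)
next
  case False
  have "\<not> set_integrable lebesgue S' f"
  proof
    assume "set_integrable lebesgue S' f"
    then have "set_integrable lebesgue S f"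
      by (rule set_integrable_lebesgue_translate[where t = "- t"])
        (use assms(1)[of "- t + x" for x] assms(2)[of "- t + x" for x] in auto)
    with False show False ..
  qed
  with False show ?thesis
    by (simp add: set_integrable_def set_lebesgue_integral_def not_integrable_integral_eq)
qed

text \<open>The cells with indices \<open>0..<N\<close> tile \<open>[-h/2, 1 - h/2]\<close>, not \<open>[0, 1]\<close>; periodicity moves the
  overhanging half cell back.\<close>

lemma sum_additive_interval_function:
  fixes F :: "real \<Rightarrow> real \<Rightarrow> real"
  assumes add: "\<And>a b c. - 1 \<le> a \<Longrightarrow> a \<le> b \<Longrightarrow> b \<le> c \<Longrightarrow> c \<le> 1 \<Longrightarrow> F a c = F a b + F b c"
    and per: "\<And>a b. F (a + 1) (b + 1) = F a b"
    and "N > 0"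
  shows "(\<Sum>i\<in>{0..<int N}. F (real_of_int i * mesh N - mesh N / 2) (real_of_int i * mesh N + mesh N / 2))
    = F 0 1"
proof -
  define h where "h = mesh N"
  have h: "0 < h" "h \<le> 1" "real N * h = 1"
    using \<open>N > 0\<close> by (simp_all add: h_def mesh_def)
  have *: "(\<Sum>i\<in>{0..<n}. F (real i * h - h / 2) (real i * h + h / 2)) = F (- h / 2) (real n * h - h / 2)"
    if "n \<le> N" for n
    using that
  proof (induction n)
    case 0
    \<comment> \<open>Additivity on a degenerate interval forces its value to be 0.\<close>
    show ?case using add[of "- h / 2" "- h / 2" "- h / 2"] h by simp
  next
    case (Suc n)
    have "real (Suc n) * h \<le> 1"
      using Suc.prems h mult_right_mono[of "real (Suc n)" "real N" h] by simp
    then have "F (- h / 2) (real (Suc n) * h - h / 2)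
        = F (- h / 2) (real n * h - h / 2) + F (real n * h - h / 2) (real (Suc n) * h - h / 2)"
      using h by (intro add) (auto simp: algebra_simps)
    moreover have "real (Suc n) * h - h / 2 = real n * h + h / 2" by (simp add: algebra_simps)
    moreover have "(\<Sum>i\<in>{0..<n}. F (real i * h - h / 2) (real i * h + h / 2))
        = F (- h / 2) (real n * h - h / 2)" using Suc by simp
    ultimately show ?case by (simp only: sum.atLeast0_lessThan_Suc)
  qed
  have "(\<Sum>i\<in>{0..<int N}. F (real_of_int i * h - h / 2) (real_of_int i * h + h / 2))
      = (\<Sum>i\<in>{0..<N}. F (real i * h - h / 2) (real i * h + h / 2))"
    by (rule sum.reindex_bij_witness[where i = int and j = nat]) auto
  also have "\<dots> = F (- h / 2) (1 - h / 2)" using * h by simp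
  also have "\<dots> = F (- h / 2) 0 + F 0 (1 - h / 2)" using h by (intro add) auto
  also have "F (- h / 2) 0 = F (1 - h / 2) 1" using per[of "- h / 2" 0] by (simp add: add.commute)
  also have "F (1 - h / 2) 1 + F 0 (1 - h / 2) = F 0 1" using add[of 0 "1 - h / 2" 1] h by simp
  finally show ?thesis by (simp add: h_def)
qed

lemma cell_eq:
  "cell N i j = {real_of_int i * mesh N - mesh N / 2..real_of_int i * mesh N + mesh N / 2}
      \<times> {real_of_int j * mesh N - mesh N / 2..real_of_int j * mesh N + mesh N / 2}"
proof -
  have *: "\<bar>x - c\<bar> \<le> r \<longleftrightarrow> x \<in> {c - r..c + r}" for x c r :: real by auto
  show ?thesis unfolding cell_def * by auto
qed

lemma box_lebesgue [simp]: "{a..b} \<times> {c..d} \<in> sets lebesgue" for a b c d :: real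
proof -
  have "{a..b} \<times> {c..d} = cbox (a, c) (b, d)" by (simp add: cbox_Pair_eq)
  then show ?thesis by simp
qed

text \<open>Coordinate lines are hyperplanes, hence null. This disposes of the common edges of
  adjacent boxes and of rounding ties on cell boundaries.\<close>

lemma AE_lebesgue_not_line:
  fixes c :: real
  shows "AE z :: real \<times> real in lebesgue. fst z \<noteq> c" "AE z :: real \<times> real in lebesgue. snd z \<noteq> c"
proof -
  have "negligible {z :: real \<times> real. z \<bullet> (1, 0) = c}" "negligible {z :: real \<times> real. z \<bullet> (0, 1) = c}"
    by (rule negligible_standard_hyperplane; simp add: Basis_prod_def)+
  then have "{z :: real \<times> real. z \<bullet> (1, 0) = c} \<in> null_sets lebesgue"
    "{z :: real \<times> real. z \<bullet> (0, 1) = c} \<in> null_sets lebesgue"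
    by (simp_all add: negligible_iff_null_sets)
  from this[THEN AE_not_in]
  show "AE z :: real \<times> real in lebesgue. fst z \<noteq> c" "AE z :: real \<times> real in lebesgue. snd z \<noteq> c"
    by (auto simp: inner_prod_def)
qed

text \<open>A translated copy in \<open>x\<close> and then one in \<open>y\<close> enlarge the unit
  square to the square with side \<open>[-1, 1]\<close>, which contains the cells overhanging to the
  left and below.\<close>

lemma torus_fun_integrable_box:
  fixes m :: "real \<times> real \<Rightarrow> real"
  assumes m: "torus_fun m" "set_integrable lebesgue ({0..1} \<times> {0..1}) m"
    and "- 1 \<le> a" "b \<le> 1" "- 1 \<le> c" "d \<le> 1"
  shows "set_integrable lebesgue ({a..b} \<times> {c..d}) m"
proof -
  have "set_integrable lebesgue ({- 1..0} \<times> {0..1}) m"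
    by (rule set_integrable_lebesgue_translate[OF m(2), of "(1, 0)"])
      (use m(1) in \<open>auto simp: torus_fun_def add.commute\<close>)
  with m(2) have "set_integrable lebesgue ({- 1..0} \<times> {0..1} \<union> {0..1} \<times> {0..1}) m"
    by (intro set_integrable_Un) auto
  then have 1: "set_integrable lebesgue ({- 1..1} \<times> {0..1}) m"
    by (rule set_integrable_subset) auto
  have "set_integrable lebesgue ({- 1..1} \<times> {- 1..0}) m"
    by (rule set_integrable_lebesgue_translate[OF 1, of "(0, 1)"])
      (use m(1) in \<open>auto simp: torus_fun_def add.commute\<close>)
  with 1 have "set_integrable lebesgue ({- 1..1} \<times> {- 1..0} \<union> {- 1..1} \<times> {0..1}) m"
    by (intro set_integrable_Un) auto
  then show ?thesis
    by (rule set_integrable_subset) (use assms(3-) in auto)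
qed

text \<open>Applies \<open>sum_additive_interval_function\<close> twice: to the \<open>y\<close>
  range over a fixed vertical strip, then to the \<open>x\<close> range with the full
  \<open>y\<close> period.\<close>

lemma sum_cell_integrals:
  fixes m :: "real \<times> real \<Rightarrow> real"
  assumes m: "torus_fun m" "set_integrable lebesgue ({0..1} \<times> {0..1}) m" and "N > 0"
  shows "(\<Sum>i\<in>{0..<int N}. \<Sum>j\<in>{0..<int N}. LINT x:cell N i j|lebesgue. m x)
    = (LINT x:{0..1} \<times> {0..1}|lebesgue. m x)"
proof -
  define \<Phi> where "\<Phi> a b c d = (LINT x:{a..b} \<times> {c..d}|lebesgue. m x)" for a b c d
  have h: "mesh N > 0" "mesh N \<le> 1" "mesh N * real N = 1"
    using \<open>N > 0\<close> by (simp_all add: mesh_def)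
  note int = torus_fun_integrable_box[OF m]
  have x_add: "\<Phi> a c 0 1 = \<Phi> a b 0 1 + \<Phi> b c 0 1"
    if "- 1 \<le> a" "a \<le> b" "b \<le> c" "c \<le> 1" for a b c
  proof -
    have "{a..c} \<times> {0..1::real} = {a..b} \<times> {0..1} \<union> {b..c} \<times> {0..1}" using that by auto
    moreover have "AE z in lebesgue. \<not> (z \<in> {a..b} \<times> {0..1::real} \<and> z \<in> {b..c} \<times> {0..1})"
      using AE_lebesgue_not_line(1)[of b] by eventually_elim auto
    ultimately show ?thesis
      unfolding \<Phi>_def using that by (simp add: set_integral_Un_AE int)
  qed
  have y_add: "\<Phi> a b c e = \<Phi> a b c d + \<Phi> a b d e"
    if "- 1 \<le> c" "c \<le> d" "d \<le> e" "e \<le> 1" "- 1 \<le> a" "b \<le> 1" for a b c d e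
  proof -
    have "{a..b} \<times> {c..e} = {a..b} \<times> {c..d} \<union> {a..b} \<times> {d..e}" using that by auto
    moreover have "AE z in lebesgue. \<not> (z \<in> {a..b} \<times> {c..d} \<and> z \<in> {a..b} \<times> {d..e})"
      using AE_lebesgue_not_line(2)[of d] by eventually_elim auto
    ultimately show ?thesis
      unfolding \<Phi>_def using that by (simp add: set_integral_Un_AE int)
  qed
  have x_per: "\<Phi> (a + 1) (b + 1) c d = \<Phi> a b c d" for a b c d
    unfolding \<Phi>_def
    by (rule set_integral_lebesgue_translate[of _ "(1, 0)", symmetric])
      (use m(1) in \<open>auto simp: torus_fun_def add.commute\<close>)
  have y_per: "\<Phi> a b (c + 1) (d + 1) = \<Phi> a b c d" for a b c d
    unfolding \<Phi>_def
    by (rule set_integral_lebesgue_translate[of _ "(0, 1)", symmetric])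
      (use m(1) in \<open>auto simp: torus_fun_def add.commute\<close>)
  have "(\<Sum>j\<in>{0..<int N}. LINT x:cell N i j|lebesgue. m x)
      = \<Phi> (real_of_int i * mesh N - mesh N / 2) (real_of_int i * mesh N + mesh N / 2) 0 1"
    if i: "i \<in> {0..<int N}" for i
  proof -
    have "0 \<le> real_of_int i * mesh N" using h i by simp
    moreover have "(real_of_int i + 1) * mesh N \<le> real N * mesh N"
      using h i by (intro mult_right_mono) auto
    then have "real_of_int i * mesh N + mesh N \<le> 1"
      using h by (simp add: algebra_simps)
    ultimately have "- 1 \<le> real_of_int i * mesh N - mesh N / 2"
      "real_of_int i * mesh N + mesh N / 2 \<le> 1" using h by linarith+
    then show ?thesis
      unfolding cell_eq \<Phi>_def[symmetric]
      by (intro sum_additive_interval_function y_add y_per \<open>N > 0\<close>)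
  qed
  then have "(\<Sum>i\<in>{0..<int N}. \<Sum>j\<in>{0..<int N}. LINT x:cell N i j|lebesgue. m x)
     = (\<Sum>i\<in>{0..<int N}. \<Phi> (real_of_int i * mesh N - mesh N / 2) (real_of_int i * mesh N + mesh N / 2) 0 1)"
    by (rule sum.cong[OF refl])
  also have "\<dots> = \<Phi> 0 1 0 1"
    by (rule sum_additive_interval_function[where F = "\<lambda>a b. \<Phi> a b 0 1", OF x_add x_per \<open>N > 0\<close>])
  finally show ?thesis by (simp add: \<Phi>_def)
qed

section \<open>Passing between densities and discrete densities\<close>

lemma cell_average_mem_densities:
  assumes m: "m \<in> densities" and "N > 0"
  shows "cell_average N m \<in> grid_densities N"
proof -
  have torus: "torus_fun m" and int: "set_integrable lebesgue ({0..1} \<times> {0..1}) m"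
    and ae: "AE x in lebesgue. m x \<ge> 0" and 1: "(LINT x:{0..1} \<times> {0..1}|lebesgue. m x) = 1"
    using m by (auto simp: densities_def)
  have h: "mesh N > 0" "real N * mesh N = 1" using \<open>N > 0\<close> by (simp_all add: mesh_def)
  have "(LINT x:cell N (i + int N) j|lebesgue. m x) = (LINT x:cell N i j|lebesgue. m x)"
    "(LINT x:cell N i (j + int N)|lebesgue. m x) = (LINT x:cell N i j|lebesgue. m x)" for i j
  proof -
    show "(LINT x:cell N (i + int N) j|lebesgue. m x) = (LINT x:cell N i j|lebesgue. m x)"
      by (rule set_integral_lebesgue_translate[of _ "(1, 0)", symmetric])
        (use torus h in \<open>auto simp: torus_fun_def add.commute cell_def algebra_simps\<close>)
    show "(LINT x:cell N i (j + int N)|lebesgue. m x) = (LINT x:cell N i j|lebesgue. m x)"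
      by (rule set_integral_lebesgue_translate[of _ "(0, 1)", symmetric])
        (use torus h in \<open>auto simp: torus_fun_def add.commute cell_def algebra_simps\<close>)
  qed
  then have "grid_fun N (cell_average N m)"
    by (simp add: grid_fun_def cell_average_def)
  moreover have "grid_mean N (cell_average N m) = 1"
    using sum_cell_integrals[OF torus int \<open>N > 0\<close>] 1 h
    by (simp add: grid_inner_def cell_average_def flip: sum_divide_distrib)
  moreover have "cell_average N m i j \<ge> 0" for i j
  proof -
    have "AE x in lebesgue. indicat_real (cell N i j) x *\<^sub>R m x \<ge> 0"
      using ae by eventually_elim simp
    then show ?thesis
      by (simp add: cell_average_def set_lebesgue_integral_def integral_nonneg_AE)
  qed
  ultimately show ?thesis by (simp add: grid_densities_def)
qed

lemma grid_fun_le_norm_inf: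
  assumes "grid_fun N U" "N > 0"
  shows "\<bar>U i j\<bar> \<le> grid_norm_inf N U"
proof -
  have "\<bar>U i j\<bar> = \<bar>U (i mod int N) (j mod int N)\<bar>" using grid_fun_mod[OF assms(1), of i j] by simp
  also have "\<dots> \<le> grid_norm_inf N U"
    unfolding grid_norm_inf_def using assms(2) by (intro Max_ge) auto
  finally show ?thesis .
qed

text \<open>Ensures that the coupling evaluates \<open>f\<close> only inside its class. The
  reconstruction is measurable and bounded, and its mass is found cell by cell.\<close>

lemma pw_const_mem_densities:
  assumes M: "M \<in> grid_densities N" and "N > 0"
  shows "pw_const N M \<in> densities"
proof -
  have Mfun: "grid_fun N M" and mean: "grid_mean N M = 1" and pos: "\<And>i j. M i j \<ge> 0"
    using M by (auto simp: grid_densities_def)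
  have h: "mesh N > 0" "1 / mesh N = real N" using \<open>N > 0\<close> by (simp_all add: mesh_def)
  \<comment> \<open>Since \<open>1 / mesh N\<close> is the integer \<open>N\<close>, a unit shift
    moves the rounded index by exactly \<open>N\<close>.\<close>
  have round_shift: "round ((x + 1) / mesh N) = round (x / mesh N) + int N" for x :: real
    using h unfolding round_def add_divide_distrib by linarith
  have torus: "torus_fun (pw_const N M)"
    using Mfun by (simp add: torus_fun_def pw_const_def round_shift grid_fun_def)
  have round_meas: "(\<lambda>x::real. round x) \<in> borel \<rightarrow>\<^sub>M count_space UNIV"
    unfolding round_def by measurable
  have meas: "pw_const N M \<in> borel_measurable borel"
  proof -
    \<comment> \<open>Rounding maps into a countable discrete space, and every function on the
      product of two such spaces is measurable.\<close>
    have "(\<lambda>z. (round (fst z / mesh N), round (snd z / mesh N))) \<in> borel \<rightarrow>\<^sub>M count_space UNIV \<Otimes>\<^sub>M count_space UNIV"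
      by (intro measurable_Pair measurable_compose[OF _ round_meas]
          borel_measurable_continuous_onI continuous_intros) (use h in auto)
    moreover have "case_prod M \<in> borel_measurable (count_space UNIV \<Otimes>\<^sub>M count_space UNIV)"
      by (simp add: pair_measure_countable)
    ultimately have "(\<lambda>z. case_prod M (round (fst z / mesh N), round (snd z / mesh N))) \<in> borel_measurable borel"
      by (rule measurable_compose)
    then show ?thesis by (simp add: pw_const_def case_prod_unfold)
  qed
  then have meas': "pw_const N M \<in> borel_measurable lebesgue"
    by (simp add: measurable_completion)
  have bound: "norm (pw_const N M z) \<le> grid_norm_inf N M" for z
    using grid_fun_le_norm_inf[OF Mfun \<open>N > 0\<close>] by (simp add: pw_const_def case_prod_unfold)
  have int: "set_integrable lebesgue ({0..1} \<times> {0..1}) (pw_const N M)"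
    unfolding set_integrable_def
  proof (rule integrableI_bounded_set_indicator[where B = "grid_norm_inf N M"])
    have eq: "{0..1} \<times> {0..1} = cbox (0::real, 0::real) (1, 1)" by (simp add: cbox_Pair_eq)
    show "emeasure lebesgue ({0..1::real} \<times> {0..1::real}) < \<infinity>"
      unfolding eq using emeasure_lborel_cbox_finite[of "(0::real, 0::real)" "(1, 1)"] by simp
  qed (use meas' bound in auto)
  have "(LINT x:cell N i j|lebesgue. pw_const N M x) = (mesh N)\<^sup>2 * M i j" for i j
  proof -
    have "(LINT x:cell N i j|lebesgue. pw_const N M x) = (LINT x:cell N i j|lebesgue. M i j)"
    proof (rule set_lebesgue_integral_cong_AE)
      \<comment> \<open>Off the four boundary lines of the cell both coordinates round to its own
        index.\<close>
      show "AE x\<in>cell N i j in lebesgue. pw_const N M x = M i j"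
        using AE_lebesgue_not_line(1)[of "real_of_int i * mesh N - mesh N / 2"]
          AE_lebesgue_not_line(1)[of "real_of_int i * mesh N + mesh N / 2"]
          AE_lebesgue_not_line(2)[of "real_of_int j * mesh N - mesh N / 2"]
          AE_lebesgue_not_line(2)[of "real_of_int j * mesh N + mesh N / 2"]
      proof eventually_elim
        case (elim z)
        have rnd: "round (x / mesh N) = k"
          if "real_of_int k * mesh N - mesh N / 2 < x" "x < real_of_int k * mesh N + mesh N / 2" for x k
        proof (rule round_unique')
          have "x / mesh N - real_of_int k = (x - real_of_int k * mesh N) / mesh N"
            using h by (simp add: field_simps)
          moreover have "\<bar>x - real_of_int k * mesh N\<bar> < 1 / 2 * mesh N"
            using that by linarith
          ultimately show "\<bar>x / mesh N - real_of_int k\<bar> < 1 / 2"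
            using h by (simp only: abs_divide pos_divide_less_eq abs_of_pos)
        qed
        show ?case
          using elim rnd[of i "fst z"] rnd[of j "snd z"]
          by (auto simp: cell_eq pw_const_def case_prod_unfold)
      qed
    qed (use meas' in \<open>auto simp: cell_eq\<close>)
    also have "\<dots> = measure lebesgue (cell N i j) * M i j"
      by (simp add: cell_eq set_lebesgue_integral_def)
    also have "measure lebesgue (cell N i j) = (mesh N)\<^sup>2"
    proof -
      have "cell N i j = cbox (real_of_int i * mesh N - mesh N / 2, real_of_int j * mesh N - mesh N / 2)
           (real_of_int i * mesh N + mesh N / 2, real_of_int j * mesh N + mesh N / 2)"
        by (simp add: cell_eq cbox_Pair_eq)
      then show ?thesis using h by (simp add: content_Pair power2_eq_square)
    qed
    finally show ?thesis .
  qed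
  then have "(LINT x:{0..1} \<times> {0..1}|lebesgue. pw_const N M x) = 1"
    using sum_cell_integrals[OF torus int \<open>N > 0\<close>] mean
    by (simp add: grid_inner_def flip: sum_distrib_left)
  with torus int pos show ?thesis
    by (simp add: densities_def pw_const_def case_prod_unfold)
qed

section \<open>Existence of discrete solutions\<close>

text \<open>A retraction of the nonnegative grid functions onto the densities.\<close>

definition to_density :: "nat \<Rightarrow> grid_fn \<Rightarrow> grid_fn" where
  "to_density N W i j = (W i j + max 0 (1 - grid_mean N W)) / max 1 (grid_mean N W)"

text \<open>A mean below 1 is topped up by a constant, a mean above 1 is divided out. The
  denominator is at least 1, so the formula is continuous even at the zero function.\<close>

lemma to_density_mem_densities:
  assumes "grid_fun N W" "\<And>i j. W i j \<ge> 0" "N > 0"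
  shows "to_density N W \<in> grid_densities N"
proof -
  have "to_density N W = (\<lambda>i j. (W i j + max 0 (1 - grid_mean N W)) / max 1 (grid_mean N W))"
    by (simp add: fun_eq_iff to_density_def)
  then have "grid_mean N (to_density N W)
      = (grid_mean N W + max 0 (1 - grid_mean N W)) / max 1 (grid_mean N W)"
    using grid_mean_const[OF \<open>N > 0\<close>] by (simp only: grid_mean_divide grid_mean_add)
  also have "\<dots> = 1" by (auto simp: max_def)
  finally have "grid_mean N (to_density N W) = 1" .
  moreover have "to_density N W i j \<ge> 0" for i j
    using assms(2)[of i j] by (simp add: to_density_def)
  ultimately show ?thesis
    using assms(1) by (simp add: grid_densities_def grid_fun_def to_density_def)
qed

lemma to_density_ident: "W \<in> grid_densities N \<Longrightarrow> to_density N W = W"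
  by (simp add: fun_eq_iff to_density_def grid_densities_def)

text \<open>A single value is at most the sum over the fundamental square, and mean 1 makes that sum
  the number of grid points. This supplies the upper faces of the box for \<open>M\<close>.\<close>

lemma grid_densities_le:
  assumes "M \<in> grid_densities N" "N > 0"
  shows "M i j \<le> (real N)\<^sup>2"
proof -
  have M: "grid_fun N M" "grid_mean N M = 1" "\<And>i j. M i j \<ge> 0"
    using assms by (auto simp: grid_densities_def)
  have "M i j = M (i mod int N) (j mod int N)" by (rule grid_fun_mod[OF M(1)])
  also have "\<dots> \<le> (\<Sum>j\<in>{0..<int N}. M (i mod int N) j)"
    using assms(2) M(3) by (intro member_le_sum) auto
  also have "\<dots> \<le> (\<Sum>i\<in>{0..<int N}. \<Sum>j\<in>{0..<int N}. M i j)"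
    using assms(2) M(3)
    by (intro member_le_sum[where f = "\<lambda>i. \<Sum>j\<in>{0..<int N}. M i j"] sum_nonneg) auto
  also have "\<dots> = (real N)\<^sup>2"
    using M(2) \<open>N > 0\<close> by (simp add: grid_inner_def mesh_def field_simps)
  finally show ?thesis .
qed

lemma grid_fun_hj_residual:
  assumes "torus_fun g" "N > 0" "\<And>k. grid_fun N (U k)" "grid_fun N F"
  shows "grid_fun N (hj_residual \<alpha> \<Delta>t Nt N g F U n)"
  using grid_fun_laplace[OF assms(3)] assms
  by (simp add: grid_fun_def[of N "hj_residual \<alpha> \<Delta>t Nt N g F U n"] hj_residual_def Dh_shift
      torus_fun_grid_pt grid_fun_shift(5,6))

text \<open>The coupling is abstracted to a continuous, bounded map \<open>F\<close> on densities.
  Since the box also contains arrays that are not densities, all residuals are evaluated at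
  retracted values, and the retraction is removed once a zero is found.\<close>

lemma discrete_mfg_exists:
  fixes F :: "grid_fn \<Rightarrow> grid_fn"
  assumes H: "admissible_hamiltonian H g" and \<alpha>: "0 < \<alpha>" "\<alpha> < 1" "0 < \<Delta>t" and N: "N > 0"
    and Fcont: "continuous_on (grid_densities N) F"
    and Fper: "\<And>M. M \<in> grid_densities N \<Longrightarrow> grid_fun N (F M)"
    and Fbound: "\<And>M i j. M \<in> grid_densities N \<Longrightarrow> \<bar>F M i j\<bar> \<le> B"
    and uT: "grid_fun N uT" and M0: "M0 \<in> grid_densities N"
  shows "\<exists>U M. U Nt = uT \<and> M 0 = M0 \<and> (\<forall>n. grid_fun N (U n)) \<and> (\<forall>n. M n \<in> grid_densities N)
    \<and> (\<forall>n<Nt. \<forall>i j. hj_residual \<alpha> \<Delta>t Nt N g (F (M (n + 1))) U n i j = 0)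
    \<and> (\<forall>n<Nt. \<forall>i j. fp_residual \<alpha> \<Delta>t N g U M n i j = 0)"
proof -
  have torus: "torus_fun g" and C1: "C1_fun (\<lambda>(x, q). g x q)"
    using H by (auto simp: admissible_hamiltonian_def)
  have h: "mesh N > 0" using N by (simp add: mesh_def)
  have \<rho>: "caputo_rho \<alpha> \<Delta>t > 0" by (rule caputo_rho_pos[OF \<alpha>])
  obtain A where A: "\<And>i j. \<bar>uT i j\<bar> \<le> A" using grid_fun_le_norm_inf[OF uT N] by blast
  have "grid_fun N (\<lambda>i j. g (grid_pt N i j) 0)"
    using torus N by (simp add: grid_fun_def torus_fun_grid_pt)
  then obtain G0 where G0: "\<And>i j. \<bar>g (grid_pt N i j) 0\<bar> \<le> G0"
    using grid_fun_le_norm_inf[OF _ N, of "\<lambda>i j. g (grid_pt N i j) 0"] by blast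
  define K where "K = B + G0"
  have "B \<ge> 0" using Fbound[OF M0, of 0 0] by linarith
  moreover have "G0 \<ge> 0" using G0[of 0 0] by linarith
  ultimately have "K \<ge> 0" by (simp add: K_def)
  \<comment> \<open>Each earlier radius exceeds every later one by at least
    \<open>caputo_rho \<alpha> \<Delta>t * K\<close>, the gap needed at the faces, where
    \<open>K\<close> bounds the source and \<open>g\<close> at zero gradient. The summand 1 keeps
    the intervals nondegenerate when the data vanish.\<close>
  define R where "R n = \<bar>A\<bar> + 1 + (real Nt - real n) * (caputo_rho \<alpha> \<Delta>t * K)" for n
  have Rstep: "R k \<le> R n - caputo_rho \<alpha> \<Delta>t * K" if "n < k" for n k
  proof -
    have "1 * (caputo_rho \<alpha> \<Delta>t * K) \<le> (real k - real n) * (caputo_rho \<alpha> \<Delta>t * K)"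
      using that \<rho> \<open>K \<ge> 0\<close> by (intro mult_right_mono) auto
    then show ?thesis by (simp add: R_def algebra_simps)
  qed
  have Rpos: "R n > 0" if "n \<le> Nt" for n
  proof -
    have "0 \<le> (real Nt - real n) * (caputo_rho \<alpha> \<Delta>t * K)" using that \<rho> \<open>K \<ge> 0\<close> by simp
    then show ?thesis unfolding R_def by linarith
  qed

  \<comment> \<open>\<open>(False, n, i, j)\<close> indexes the unknown \<open>U\<^sup>n\<close> and \<open>(True, n, i, j)\<close> the unknown \<open>M\<^sup>n\<^sup>+\<^sup>1\<close>.\<close>
  define I :: "(bool \<times> nat \<times> int \<times> int) set"
    where "I = UNIV \<times> {0..<Nt} \<times> {0..<int N} \<times> {0..<int N}"
  \<comment> \<open>Off \<open>I\<close> both bounds are 0, which freezes the surplus coordinates.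
    The unknowns for \<open>M\<close> range over \<open>[0, N^2]\<close>, where
    \<open>grid_densities_le\<close> places every density.\<close>
  define a where "a = (\<lambda>(s, n, i, j). if (s, n, i, j) \<in> I \<and> \<not> s then - R n else 0)"
  define b where "b = (\<lambda>(s, n, i, j). if (s, n, i, j) \<in> I then if s then (real N)\<^sup>2 else R n else 0)"
  define Bx where "Bx = {x. \<forall>k. a k \<le> x k \<and> x k \<le> b k}"
  define W where "W x n = (\<lambda>i j. x (True, n, i mod int N, j mod int N))"
    for x :: "bool \<times> nat \<times> int \<times> int \<Rightarrow> real" and n
  define U where "U x n = (if n < Nt then \<lambda>i j. x (False, n, i mod int N, j mod int N) else uT)"
    for x :: "bool \<times> nat \<times> int \<times> int \<Rightarrow> real" and n
  \<comment> \<open>On the box, the coordinates behind levels above \<open>Nt\<close> are 0 and the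
    retraction turns them into the constant 1, so every level is a density.\<close>
  define M where "M x n = (case n of 0 \<Rightarrow> M0 | Suc k \<Rightarrow> to_density N (W x k))" for x n
  \<comment> \<open>The raw coordinate, not its retraction, is compared with the step. On the faces
    0 and \<open>N^2\<close> the sign is then clear because the step is a density.\<close>
  define G where "G x = (\<lambda>(s, n, i, j). if s then x (s, n, i, j) - fp_step \<alpha> \<Delta>t N g (U x) (M x) n i j
      else hj_residual \<alpha> \<Delta>t Nt N g (F (M x (n + 1))) (U x) n i j)" for x
  have Ifin: "finite I" by (simp add: I_def)
  have ab: "a k < b k" if "k \<in> I" for k
    using that Rpos N by (auto simp: a_def b_def I_def split: prod.splits)
  have ab': "a k = b k" if "k \<notin> I" for k
    using that by (auto simp: a_def b_def split: prod.splits)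
  have Ufun: "grid_fun N (U x n)" for x n
    using uT by (simp add: U_def grid_fun_def)
  have Ubound: "\<bar>U x n i j\<bar> \<le> R n" if "x \<in> Bx" "n \<le> Nt" for x n i j
  proof (cases "n < Nt")
    case True
    let ?k = "(False, n, i mod int N, j mod int N)"
    have "?k \<in> I" using True N by (simp add: I_def)
    moreover have "a ?k \<le> x ?k" "x ?k \<le> b ?k" using that by (simp_all add: Bx_def)
    ultimately show ?thesis using True by (simp add: U_def a_def b_def abs_le_iff)
  next
    case False
    then have "n = Nt" using that by simp
    then show ?thesis using A[of i j] by (simp add: U_def R_def)
  qed
  have Mdens: "M x n \<in> grid_densities N" if "x \<in> Bx" for x n
  proof (cases n)
    case (Suc k)
    have "W x k i j \<ge> 0" for i j
    proof -
      have "a (True, k, i mod int N, j mod int N) \<le> W x k i j"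
        using that by (simp add: Bx_def W_def)
      then show ?thesis by (simp add: a_def)
    qed
    then have "to_density N (W x k) \<in> grid_densities N"
      using N by (intro to_density_mem_densities) (simp_all add: W_def grid_fun_def)
    then show ?thesis by (simp add: M_def Suc)
  qed (simp add: M_def M0)
  have step_dens: "fp_step \<alpha> \<Delta>t N g (U x) (M x) n \<in> grid_densities N" if "x \<in> Bx" for x n
    using Mdens[OF that] by (intro fp_step_mem_densities[OF H \<alpha> N Ufun])

  \<comment> \<open>Continuity of the map on the box\<close>
  have x_cont [continuous_intros]: "continuous_on Bx (\<lambda>x. x k)" for k
    by (rule continuous_on_subset[OF continuous_on_product_coordinates]) simp
  have U_cont [continuous_intros]: "continuous_on Bx (\<lambda>x. U x n i j)" for n i j
    by (cases "n < Nt") (simp_all add: U_def x_cont)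
  have mean_cont: "continuous_on Bx (\<lambda>x. grid_mean N (W x n))" for n
    unfolding grid_inner_def W_def by (intro continuous_intros)
  have M_cont [continuous_intros]: "continuous_on Bx (\<lambda>x. M x n i j)" for n i j
  proof (cases n)
    case (Suc k)
    have "continuous_on Bx (\<lambda>x. to_density N (W x k) i j)"
      unfolding to_density_def
      by (intro continuous_intros mean_cont) (auto simp: W_def intro!: continuous_intros)
    then show ?thesis by (simp add: M_def Suc)
  qed (simp add: M_def)
  have FM_cont [continuous_intros]: "continuous_on Bx (\<lambda>x. F (M x n) i j)" for n i j
  proof -
    \<comment> \<open>Continuity of \<open>F\<close> is known only on densities, so the composition
      needs \<open>Mdens\<close> to keep the argument there.\<close>
    have "continuous_on Bx (\<lambda>x. M x n)"
      by (intro continuous_on_coordinatewise_then_product M_cont)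
    then have "continuous_on Bx (\<lambda>x. F (M x n))"
      using Mdens by (intro continuous_on_compose2[OF Fcont]) auto
    then show ?thesis
      by (rule continuous_on_product_then_coordinatewise[OF continuous_on_product_then_coordinatewise])
  qed
  have Dh_cont: "continuous_on Bx (\<lambda>x. Dh N (U x n) i j)" for n i j
  proof -
    have "continuous_on Bx (\<lambda>x. Dh N (U x n) i j $ l)" for l
      using exhaust_4[of l]
      by (elim disjE; simp add: Dh_def D1p_def D2p_def vector_4_nth; intro continuous_intros; use h in simp)
    then have "continuous_on Bx (\<lambda>x. \<chi> l. Dh N (U x n) i j $ l)"
      by (rule continuous_on_vec_lambda)
    then show ?thesis by simp
  qed
  have g_cont [continuous_intros]: "continuous_on Bx (\<lambda>x. g (grid_pt N i j) (Dh N (U x n) i j))" for n i j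
    by (rule continuous_on_compose2[OF partial_q_C1(3)[OF C1] Dh_cont]) simp
  have drift_cont [continuous_intros]: "continuous_on Bx (\<lambda>x. drift N g (U x n) l i j)" for n l i j
    unfolding drift_def
    by (rule continuous_on_compose2[OF partial_q_C1(2)[OF C1] Dh_cont]) simp
  have rate_cont [continuous_intros]: "continuous_on Bx (\<lambda>x. fp_rate \<alpha> \<Delta>t N g (U x n))" for n
    unfolding fp_rate_def fp_diag_def using h by (intro continuous_intros) auto
  have step_cont [continuous_intros]: "continuous_on Bx (\<lambda>x. fp_step \<alpha> \<Delta>t N g (U x) (M x) n i j)" for n i j
    unfolding fp_step_def fp_residual_def caputo_fwd_def laplace_h_def transport_eq
    by (intro continuous_intros) (simp add: fp_rate_pos[OF H \<alpha>] less_imp_neq[symmetric])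
  have res_cont [continuous_intros]:
    "continuous_on Bx (\<lambda>x. hj_residual \<alpha> \<Delta>t Nt N g (F (M x m)) (U x) n i j)" for m n i j
    unfolding hj_residual_def caputo_bwd_def laplace_h_def by (intro continuous_intros)
  have G_cont: "continuous_on Bx (\<lambda>x. G x k)" for k
  proof -
    obtain s n i j where "k = (s, n, i, j)" by (cases k) auto
    then show ?thesis
      using res_cont[of "n + 1" n i j] by (cases s) (auto simp: G_def intro!: continuous_intros)
  qed

  \<comment> \<open>Signs of the map on the faces\<close>
  have G_lower: "G x k \<le> 0" if x: "x \<in> Bx" and k: "k \<in> I" and xa: "x k = a k" for x k
  proof -
    obtain s n i j where k_eq: "k = (s, n, i, j)" by (cases k) auto
    have ij: "n < Nt" "i mod int N = i" "j mod int N = j" using k by (auto simp: k_eq I_def)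
    show ?thesis
    proof (cases s)
      case True
      then show ?thesis
        using step_dens[OF x, of n] k xa by (simp add: G_def k_eq a_def grid_densities_def)
    next
      case False
      then have Ueq: "U x n i j = - R n" using xa k ij by (simp add: U_def k_eq a_def)
      \<comment> \<open>All values at level \<open>n\<close> lie within radius \<open>R n\<close>,
        so touching \<open>- R n\<close> makes \<open>(i, j)\<close> a spatial minimum. The smaller
        radii at later levels provide the gap in time.\<close>
      have "hj_residual \<alpha> \<Delta>t Nt N g (F (M x (n + 1))) (U x) n i j \<le> 0"
      proof (rule hj_residual_min[OF H \<alpha> N ij(1), where K = K])
        show "U x n i j + caputo_rho \<alpha> \<Delta>t * K \<le> U x k i j" if "n < k" "k \<le> Nt" for k
          using Ubound[OF x that(2), of i j] Rstep[OF that(1)] Ueq by linarith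
        show "U x n i j \<le> U x n i' j'" for i' j'
          using Ubound[OF x, of n i' j'] Ueq ij by simp
        show "g (grid_pt N i j) 0 - F (M x (n + 1)) i j \<le> K"
          using G0[of i j] Fbound[OF Mdens[OF x], of "n + 1" i j] by (simp add: K_def)
      qed
      then show ?thesis using False by (simp add: G_def k_eq)
    qed
  qed
  have G_upper: "G x k \<ge> 0" if x: "x \<in> Bx" and k: "k \<in> I" and xb: "x k = b k" for x k
  proof -
    obtain s n i j where k_eq: "k = (s, n, i, j)" by (cases k) auto
    have ij: "n < Nt" "i mod int N = i" "j mod int N = j" using k by (auto simp: k_eq I_def)
    show ?thesis
    proof (cases s)
      case True
      then show ?thesis
        using grid_densities_le[OF step_dens[OF x, of n] N] k xb by (simp add: G_def k_eq b_def)
    next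
      case False
      then have Ueq: "U x n i j = R n" using xb k ij by (simp add: U_def k_eq b_def)
      have "hj_residual \<alpha> \<Delta>t Nt N g (F (M x (n + 1))) (U x) n i j \<ge> 0"
      proof (rule hj_residual_max[OF H \<alpha> N ij(1), where K = K])
        show "U x k i j \<le> U x n i j - caputo_rho \<alpha> \<Delta>t * K" if "n < k" "k \<le> Nt" for k
          using Ubound[OF x that(2), of i j] Rstep[OF that(1)] Ueq by linarith
        show "U x n i' j' \<le> U x n i j" for i' j'
          using Ubound[OF x, of n i' j'] Ueq ij by simp
        show "F (M x (n + 1)) i j - g (grid_pt N i j) 0 \<le> K"
          using G0[of i j] Fbound[OF Mdens[OF x], of "n + 1" i j] by (simp add: K_def)
      qed
      then show ?thesis using False by (simp add: G_def k_eq)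
    qed
  qed

  \<comment> \<open>The zero solves both schemes\<close>
  obtain x where x: "x \<in> Bx" and zero: "\<And>k. k \<in> I \<Longrightarrow> G x k = 0"
    using poincare_miranda[of I a b G, folded Bx_def, OF Ifin ab ab' G_cont G_lower G_upper] by blast
  show ?thesis
  proof (rule exI[of _ "U x"], rule exI[of _ "M x"], intro conjI allI impI)
    show "U x Nt = uT" by (simp add: U_def)
    show "M x 0 = M0" by (simp add: M_def)
    show "grid_fun N (U x n)" for n by (rule Ufun)
    show "M x n \<in> grid_densities N" for n by (rule Mdens[OF x])
    show "hj_residual \<alpha> \<Delta>t Nt N g (F (M x (n + 1))) (U x) n i j = 0" if "n < Nt" for n i j
    proof -
      \<comment> \<open>The zero of \<open>G\<close> controls one fundamental square; periodicity of
        the residual extends it to all indices.\<close>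
      have "grid_fun N (hj_residual \<alpha> \<Delta>t Nt N g (F (M x (n + 1))) (U x) n)"
        by (rule grid_fun_hj_residual[OF torus N Ufun Fper[OF Mdens[OF x]]])
      moreover have "G x (False, n, i mod int N, j mod int N) = 0"
        using that N by (intro zero) (simp add: I_def)
      ultimately show ?thesis using grid_fun_mod by (fastforce simp: G_def)
    qed
    show "fp_residual \<alpha> \<Delta>t N g (U x) (M x) n i j = 0" if "n < Nt" for n i j
    proof -
      have "W x n i j = fp_step \<alpha> \<Delta>t N g (U x) (M x) n i j" for i j
      proof -
        have "G x (True, n, i mod int N, j mod int N) = 0"
          using that N by (intro zero) (simp add: I_def)
        moreover have "grid_fun N (fp_step \<alpha> \<Delta>t N g (U x) (M x) n)"
          using step_dens[OF x, of n] by (simp add: grid_densities_def)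
        ultimately show ?thesis using grid_fun_mod by (fastforce simp: G_def W_def)
      qed
      \<comment> \<open>The raw array equals a step, hence is itself a density and is fixed by the
        retraction. So \<open>M\<close> equals its own step, and dividing by the positive rate
        leaves only a vanishing residual.\<close>
      then have W: "W x n = fp_step \<alpha> \<Delta>t N g (U x) (M x) n" by (simp add: fun_eq_iff)
      with step_dens[OF x, of n] have "M x (n + 1) = fp_step \<alpha> \<Delta>t N g (U x) (M x) n"
        by (simp add: M_def to_density_ident)
      then have "M x (n + 1) i j = fp_step \<alpha> \<Delta>t N g (U x) (M x) n i j" by simp
      then show ?thesis
        using fp_rate_pos[OF H \<alpha>, of N "U x n"] by (simp add: fp_step_def)
    qed
  qed
qed

text \<open>Specialises \<open>discrete_mfg_exists\<close>: \<open>pw_const_mem_densities\<close>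
  puts the arguments of \<open>f\<close> into \<open>X\<close>, and
  \<open>cell_average_mem_densities\<close> supplies the initial density.\<close>

theorem theorem3p2:
  fixes T \<alpha> :: real
    and Nh :: nat
    and H :: "real \<times> real \<Rightarrow> real^2 \<Rightarrow> real"
    and g :: "real \<times> real \<Rightarrow> real^4 \<Rightarrow> real"
    and X :: "(real \<times> real \<Rightarrow> real) set"
    and f :: "(real \<times> real \<Rightarrow> real) \<Rightarrow> real \<times> real \<Rightarrow> real"
    and u\<^sub>T m\<^sub>0 :: "real \<times> real \<Rightarrow> real"
  assumes "T > 0" and "0 < \<alpha>" and "\<alpha> < 1" and "Nh > 0"
    and "admissible_hamiltonian H g"
    and "admissible_coupling X f"
    and "torus_fun u\<^sub>T"
    and "m\<^sub>0 \<in> densities"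
  shows "\<exists>\<tau>>0. \<forall>\<Delta>t N. 0 < \<Delta>t \<and> \<Delta>t < \<tau> \<and> T / \<Delta>t = real N \<longrightarrow>
    (\<exists>U M :: nat \<Rightarrow> int \<Rightarrow> int \<Rightarrow> real.
       (\<forall>n\<le>N. grid_fun Nh (U n) \<and> grid_fun Nh (M n))
     \<and> (\<forall>n<N. pw_const Nh (M (n + 1)) \<in> X)
     \<and> (\<forall>n<N. \<forall>i j.
          caputo_bwd \<alpha> \<Delta>t N (\<lambda>k. U k i j) n - laplace_h Nh (U n) i j
            + g (grid_pt Nh i j) (Dh Nh (U n) i j)
            = coupling_h Nh f (M (n + 1)) i j)
     \<and> (\<forall>n<N. \<forall>i j.
          caputo_fwd \<alpha> \<Delta>t (\<lambda>k. M k i j) (n + 1) - laplace_h Nh (M (n + 1)) i j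
            - transport Nh g (U n) (M (n + 1)) i j = 0)
     \<and> (\<forall>i j. U N i j = u\<^sub>T (grid_pt Nh i j))
     \<and> (\<forall>i j. M 0 i j = cell_average Nh m\<^sub>0 i j))"
proof -
  have dens: "pw_const Nh M \<in> X" if "M \<in> grid_densities Nh" for M
    using pw_const_mem_densities[OF that \<open>Nh > 0\<close>] \<open>admissible_coupling X f\<close>
    by (auto simp: admissible_coupling_def)
  have Fper: "grid_fun Nh (coupling_h Nh f M)" if "M \<in> grid_densities Nh" for M
  proof -
    have "torus_fun (f (pw_const Nh M))"
      using dens[OF that] \<open>admissible_coupling X f\<close> by (simp add: admissible_coupling_def)
    then show ?thesis
      using \<open>Nh > 0\<close> by (simp add: grid_fun_def coupling_h_def torus_fun_grid_pt)
  qed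
  have Fcont: "continuous_on (grid_densities Nh) (coupling_h Nh f)"
    using \<open>admissible_coupling X f\<close> \<open>Nh > 0\<close> by (simp add: admissible_coupling_def)
  have "\<exists>B. \<forall>M\<in>grid_densities Nh. grid_norm_inf Nh (coupling_h Nh f M) \<le> B"
    using \<open>admissible_coupling X f\<close> \<open>Nh > 0\<close> by (simp add: admissible_coupling_def)
  then obtain B where B: "\<And>M. M \<in> grid_densities Nh \<Longrightarrow> grid_norm_inf Nh (coupling_h Nh f M) \<le> B"
    by blast
  have Fbound: "\<bar>coupling_h Nh f M i j\<bar> \<le> B" if "M \<in> grid_densities Nh" for M i j
    using grid_fun_le_norm_inf[OF Fper[OF that] \<open>Nh > 0\<close>, of i j] B[OF that] by linarith
  have uT: "grid_fun Nh (\<lambda>i j. u\<^sub>T (grid_pt Nh i j))"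
    using \<open>torus_fun u\<^sub>T\<close> \<open>Nh > 0\<close> by (simp add: grid_fun_def torus_fun_grid_pt)
  show ?thesis
  \<comment> \<open>\<open>discrete_mfg_exists\<close> covers every positive time step, so 1 serves
    as the threshold.\<close>
  proof (intro exI[of _ 1] conjI allI impI)
    fix \<Delta>t :: real and N
    assume "0 < \<Delta>t \<and> \<Delta>t < 1 \<and> T / \<Delta>t = real N"
    then have "0 < \<Delta>t" by simp
    obtain U M where UM: "U N = (\<lambda>i j. u\<^sub>T (grid_pt Nh i j))" "M 0 = cell_average Nh m\<^sub>0"
      "\<forall>n. grid_fun Nh (U n)" "\<forall>n. M n \<in> grid_densities Nh"
      "\<forall>n<N. \<forall>i j. hj_residual \<alpha> \<Delta>t N Nh g (coupling_h Nh f (M (n + 1))) U n i j = 0"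
      "\<forall>n<N. \<forall>i j. fp_residual \<alpha> \<Delta>t Nh g U M n i j = 0"
      using discrete_mfg_exists[where Nt = N, OF \<open>admissible_hamiltonian H g\<close> \<open>0 < \<alpha>\<close> \<open>\<alpha> < 1\<close>
          \<open>0 < \<Delta>t\<close> \<open>Nh > 0\<close> Fcont Fper Fbound uT
          cell_average_mem_densities[OF \<open>m\<^sub>0 \<in> densities\<close> \<open>Nh > 0\<close>]]
      by blast
    show "\<exists>U M. (\<forall>n\<le>N. grid_fun Nh (U n) \<and> grid_fun Nh (M n))
     \<and> (\<forall>n<N. pw_const Nh (M (n + 1)) \<in> X)
     \<and> (\<forall>n<N. \<forall>i j.
          caputo_bwd \<alpha> \<Delta>t N (\<lambda>k. U k i j) n - laplace_h Nh (U n) i j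
            + g (grid_pt Nh i j) (Dh Nh (U n) i j)
            = coupling_h Nh f (M (n + 1)) i j)
     \<and> (\<forall>n<N. \<forall>i j.
          caputo_fwd \<alpha> \<Delta>t (\<lambda>k. M k i j) (n + 1) - laplace_h Nh (M (n + 1)) i j
            - transport Nh g (U n) (M (n + 1)) i j = 0)
     \<and> (\<forall>i j. U N i j = u\<^sub>T (grid_pt Nh i j))
     \<and> (\<forall>i j. M 0 i j = cell_average Nh m\<^sub>0 i j)"
    proof (rule exI[of _ U], rule exI[of _ M], intro conjI allI impI)
      show "grid_fun Nh (U n)" "grid_fun Nh (M n)" for n
        using UM(3,4) by (auto simp: grid_densities_def)
      show "pw_const Nh (M (n + 1)) \<in> X" for n
        using UM(4) dens by blast
      fix i j
      show "caputo_bwd \<alpha> \<Delta>t N (\<lambda>k. U k i j) n - laplace_h Nh (U n) i j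
            + g (grid_pt Nh i j) (Dh Nh (U n) i j) = coupling_h Nh f (M (n + 1)) i j" if "n < N" for n
        using UM(5) that by (simp add: hj_residual_def)
      show "caputo_fwd \<alpha> \<Delta>t (\<lambda>k. M k i j) (n + 1) - laplace_h Nh (M (n + 1)) i j
            - transport Nh g (U n) (M (n + 1)) i j = 0" if "n < N" for n
        using UM(6) that by (simp add: fp_residual_def)
      show "U N i j = u\<^sub>T (grid_pt Nh i j)" "M 0 i j = cell_average Nh m\<^sub>0 i j"
        using UM(1,2) by simp_all
    qed
  qed simp
qed

end
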